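(* Let $\mathcal{D}$ be a domain and let $\tau\in\mathcal{E}_{\mathsf{spin}}(\mathbb{Z}^2)$ be equal to $1$ at all odd faces outside $\mathcal{D}$. Suppose $a,b,c>0$ satisfy $a,b\le c$. Then the marginal of $\mathsf{Spin}_{\mathcal{D},a,b,c}^{\tau}$ on $\sigma^\bullet$ satisfies the FKG lattice condition. In particular, for any increasing functions $f,g\colon\{-1,1\}^{F^\bullet(\mathbb{Z}^2)}\to\mathbb{R}$, \[\mathsf{Spin}_{\mathcal{D},a,b,c}^{\tau}(f(\sigma^\bullet)g(\sigma^\bullet))\ge \mathsf{Spin}_{\mathcal{D},a,b,c}^{\tau}(f(\sigma^\bullet))\,\mathsf{Spin}_{\mathcal{D},a,b,c}^{\tau}(g(\sigma^\bullet)).\]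
   Context: Faces of $\mathbb{Z}^2$ are centered at integer points; the face $(i,j)$ is even if $i+j$ is even, odd otherwise; $F^\bullet(\mathbb{Z}^2)$ and $F^\circ(\mathbb{Z}^2)$ denote the sets of even and odd faces. For $\sigma\in\{-1,1\}^{F(\mathbb{Z}^2)}$, $\sigma^\bullet$ is its restriction to $F^\bullet(\mathbb{Z}^2)$; $\{-1,1\}^{F^\bullet(\mathbb{Z}^2)}$ carries the pointwise partial order. A domain is a finite subgraph of $\mathbb{Z}^2$ consisting of a simple cycle together with everything it encloses; its faces are the enclosed faces. $\mathcal{E}_{\mathsf{spin}}(\mathbb{Z}^2)$ is the set of $\sigma\colon F(\mathbb{Z}^2)\to\{-1,1\}$ such that around every vertex at least one of the two diagonal pairs of faces (faces meeting only at that vertex) has equal spins. A vertex is of type $c$ if both diagonal pairs around it have equal spins, of type $a$ if only the south-west/north-east pair does, of type $b$ if only the north-west/south-east pair does. For $a,b,c>0$ and $\tau\in\mathcal{E}_{\mathsf{spin}}(\mathbb{Z}^2)$, $\mathsf{Spin}_{\mathcal{D},a,b,c}^{\tau}$ is the probability measure on $\sigma\in\mathcal{E}_{\mathsf{spin}}(\mathbb{Z}^2)$ equal to $\tau$ on faces outside $\mathcal{D}$, with probability proportional to $a^{N_a}b^{N_b}c^{N_c}$, $N_x$ being the number of vertices of $\mathcal{D}$ of type $x$. A measure $\mu$ on a finite distributive lattice satisfies the FKG lattice condition if $\mu(x\vee y)\mu(x\wedge y)\ge\mu(x)\mu(y)$ for all $x,y$. *)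

theory Defs
  imports Complex_Main
begin

text \<open>Conventions.
  A face of Z^2 is identified with its centre (i,j) :: int * int.
  A vertex of Z^2 is identified with the pair (i,j) :: int * int standing for the
  point (i+1/2, j+1/2); its four surrounding faces are
  SW = (i,j), SE = (i+1,j), NW = (i,j+1), NE = (i+1,j+1).
  Spin configurations are functions face => int with values in {-1,1}.\<close>

type_synonym face = "int \<times> int"
type_synonym vertex = "int \<times> int"

definition even_face :: "face \<Rightarrow> bool" where
  "even_face f = even (fst f + snd f)"

definition SW :: "vertex \<Rightarrow> face" where "SW v = (fst v, snd v)"
definition SE :: "vertex \<Rightarrow> face" where "SE v = (fst v + 1, snd v)"
definition NW :: "vertex \<Rightarrow> face" where "NW v = (fst v, snd v + 1)"
definition NE :: "vertex \<Rightarrow> face" where "NE v = (fst v + 1, snd v + 1)"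

definition E_spin :: "(face \<Rightarrow> int) set" where
  "E_spin = {\<sigma>. (\<forall>f. \<sigma> f = -1 \<or> \<sigma> f = 1) \<and>
                 (\<forall>v. \<sigma> (SW v) = \<sigma> (NE v) \<or> \<sigma> (NW v) = \<sigma> (SE v))}"

definition type_c :: "(face \<Rightarrow> int) \<Rightarrow> vertex \<Rightarrow> bool" where
  "type_c \<sigma> v \<longleftrightarrow> \<sigma> (SW v) = \<sigma> (NE v) \<and> \<sigma> (NW v) = \<sigma> (SE v)"
definition type_a :: "(face \<Rightarrow> int) \<Rightarrow> vertex \<Rightarrow> bool" where
  "type_a \<sigma> v \<longleftrightarrow> \<sigma> (SW v) = \<sigma> (NE v) \<and> \<sigma> (NW v) \<noteq> \<sigma> (SE v)"
definition type_b :: "(face \<Rightarrow> int) \<Rightarrow> vertex \<Rightarrow> bool" where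
  "type_b \<sigma> v \<longleftrightarrow> \<sigma> (SW v) \<noteq> \<sigma> (NE v) \<and> \<sigma> (NW v) = \<sigma> (SE v)"

definition adjacent :: "vertex \<Rightarrow> vertex \<Rightarrow> bool" where
  "adjacent u v \<longleftrightarrow> \<bar>fst u - fst v\<bar> + \<bar>snd u - snd v\<bar> = 1"

definition simple_cycle :: "vertex list \<Rightarrow> bool" where
  "simple_cycle cyc \<longleftrightarrow> length cyc \<ge> 3 \<and> distinct cyc \<and>
     (\<forall>k < length cyc. adjacent (cyc ! k) (cyc ! ((k + 1) mod length cyc)))"

text \<open>Edge k of the cycle (vertical case) is crossed by the horizontal ray from the
  centre (p,q) of a face going in the positive x direction. The vertical edge between
  vertices (i,j) and (i,j+1) is the segment x = i+1/2, j+1/2 <= y <= j+3/2.\<close>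
definition crosses :: "vertex list \<Rightarrow> nat \<Rightarrow> face \<Rightarrow> bool" where
  "crosses cyc k f \<longleftrightarrow>
     (let u = cyc ! k; w = cyc ! ((k + 1) mod length cyc) in
        fst u = fst w \<and> \<bar>snd u - snd w\<bar> = 1 \<and>
        fst u \<ge> fst f \<and> min (snd u) (snd w) = snd f - 1)"

text \<open>A face is enclosed by the cycle iff the ray crosses it an odd number of times.\<close>
definition domain_faces :: "vertex list \<Rightarrow> face set" where
  "domain_faces cyc = {f. odd (card {k. k < length cyc \<and> crosses cyc k f})}"

text \<open>Vertices of the domain (the cycle together with everything it encloses) are
  exactly the vertices incident to some enclosed face.\<close>
definition domain_vertices :: "vertex list \<Rightarrow> vertex set" where
  "domain_vertices cyc = {v. SW v \<in> domain_faces cyc \<or> SE v \<in> domain_faces cyc \<or>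
                             NW v \<in> domain_faces cyc \<or> NE v \<in> domain_faces cyc}"

definition spin_configs :: "vertex list \<Rightarrow> (face \<Rightarrow> int) \<Rightarrow> (face \<Rightarrow> int) set" where
  "spin_configs cyc \<tau> = {\<sigma>. \<sigma> \<in> E_spin \<and> (\<forall>f. f \<notin> domain_faces cyc \<longrightarrow> \<sigma> f = \<tau> f)}"

definition spin_weight :: "real \<Rightarrow> real \<Rightarrow> real \<Rightarrow> vertex list \<Rightarrow> (face \<Rightarrow> int) \<Rightarrow> real" where
  "spin_weight a b c cyc \<sigma> =
     a ^ card {v \<in> domain_vertices cyc. type_a \<sigma> v} *
     b ^ card {v \<in> domain_vertices cyc. type_b \<sigma> v} *
     c ^ card {v \<in> domain_vertices cyc. type_c \<sigma> v}"

definition spin_Z :: "real \<Rightarrow> real \<Rightarrow> real \<Rightarrow> vertex list \<Rightarrow> (face \<Rightarrow> int) \<Rightarrow> real" where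
  "spin_Z a b c cyc \<tau> = (\<Sum>\<sigma>\<in>spin_configs cyc \<tau>. spin_weight a b c cyc \<sigma>)"

definition Spin_prob :: "real \<Rightarrow> real \<Rightarrow> real \<Rightarrow> vertex list \<Rightarrow> (face \<Rightarrow> int) \<Rightarrow> (face \<Rightarrow> int) \<Rightarrow> real" where
  "Spin_prob a b c cyc \<tau> \<sigma> =
     (if \<sigma> \<in> spin_configs cyc \<tau> then spin_weight a b c cyc \<sigma> / spin_Z a b c cyc \<tau> else 0)"

definition Spin_expect :: "real \<Rightarrow> real \<Rightarrow> real \<Rightarrow> vertex list \<Rightarrow> (face \<Rightarrow> int) \<Rightarrow> ((face \<Rightarrow> int) \<Rightarrow> real) \<Rightarrow> real" where
  "Spin_expect a b c cyc \<tau> F = (\<Sum>\<sigma>\<in>spin_configs cyc \<tau>. F \<sigma> * Spin_prob a b c cyc \<tau> \<sigma>)"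

text \<open>Elements of {-1,1}^{F^bullet(Z^2)} are represented as functions face => int
  that take values in {-1,1} on even faces and are 0 on odd faces.\<close>
definition even_configs :: "(face \<Rightarrow> int) set" where
  "even_configs = {\<eta>. \<forall>f. (even_face f \<longrightarrow> \<eta> f = -1 \<or> \<eta> f = 1) \<and> (\<not> even_face f \<longrightarrow> \<eta> f = 0)}"

definition bullet :: "(face \<Rightarrow> int) \<Rightarrow> (face \<Rightarrow> int)" where
  "bullet \<sigma> = (\<lambda>f. if even_face f then \<sigma> f else 0)"

definition Spin_marginal :: "real \<Rightarrow> real \<Rightarrow> real \<Rightarrow> vertex list \<Rightarrow> (face \<Rightarrow> int) \<Rightarrow> (face \<Rightarrow> int) \<Rightarrow> real" where
  "Spin_marginal a b c cyc \<tau> \<eta> =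
     (\<Sum>\<sigma>\<in>{\<sigma> \<in> spin_configs cyc \<tau>. bullet \<sigma> = \<eta>}. Spin_prob a b c cyc \<tau> \<sigma>)"

definition FKG_lattice :: "((face \<Rightarrow> int) \<Rightarrow> real) \<Rightarrow> bool" where
  "FKG_lattice \<mu> \<longleftrightarrow> (\<forall>x\<in>even_configs. \<forall>y\<in>even_configs.
       \<mu> (sup x y) * \<mu> (inf x y) \<ge> \<mu> x * \<mu> y)"

definition increasing_even :: "((face \<Rightarrow> int) \<Rightarrow> real) \<Rightarrow> bool" where
  "increasing_even F \<longleftrightarrow> (\<forall>x\<in>even_configs. \<forall>y\<in>even_configs. x \<le> y \<longrightarrow> F x \<le> F y)"

end

theory Submission
  imports Defs "HOL-Library.Function_Algebras"
begin

text \<open>Conditionally on the even spins, the odd spins form a ferromagnetic Ising model with infinite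
  coupling at every vertex where the even diagonal pair disagrees. The disagreements of the odd
  spins are an even subgraph of the lattice of even faces that never joins a plus face to a minus
  face. It therefore splits into an even subgraph of the plus faces and one of the minus faces,
  and since the domain is simply connected each is again the disagreement set of an odd
  configuration. Hence the marginal weight of the even spins is a product of a ferromagnetic pair
  interaction (here a, b \<le> c enters), of P(plus faces) and of P(minus faces), where P is a
  high-temperature expansion with edge weights a/c or b/c in [0,1]. By the second Griffiths
  inequality P is log-supermodular, and the lattice condition follows factor by factor.
  The correlation inequality then follows from the four functions theorem.\<close>

section \<open>Griffiths' inequality for sign characters\<close>

text \<open>Griffiths' inequality compares expectations in one measure, whereas P(S) and P(T) are
  partition functions with different sets of infinite couplings. They become comparable on the group
  of all odd configurations: give weight 0 to disagreements off A \<union> B. The event that there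
  is no disagreement off A is then a product of factors (1 + s) / 2, hence a nonnegative combination
  of characters, and the joint event for A and B is the one for A \<inter> B. Infinite couplings are
  thus disagreement weights 0, and no limit is taken. The minus faces obey the same inequality
  because complementation exchanges union and intersection. The obstacle is geometric. Splitting the
  odd spins asks for a potential of a curl-free field of signs, and for a proof that this potential
  is 1 outside the domain. Integration along diagonals gives the potential on the whole plane; its
  exterior value rests on the exterior being connected, which is derived from the parity definition
  of enclosure.\<close>

definition character :: "'g::comm_monoid_mult set \<Rightarrow> ('g \<Rightarrow> real) \<Rightarrow> bool" where
  "character G \<chi> \<longleftrightarrow>
     (\<forall>g\<in>G. \<forall>h\<in>G. \<chi> (g * h) = \<chi> g * \<chi> h) \<and> (\<forall>g\<in>G. \<chi> g = 1 \<or> \<chi> g = -1)"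

text \<open>Nonnegative combinations of characters. The rule \<open>cong\<close> compares functions
  on G only, since nothing is known about a character elsewhere.\<close>

inductive char_cone :: "'g::comm_monoid_mult set \<Rightarrow> ('g \<Rightarrow> real) \<Rightarrow> bool" for G where
  char: "character G \<chi> \<Longrightarrow> char_cone G \<chi>"
| scale: "char_cone G f \<Longrightarrow> r \<ge> 0 \<Longrightarrow> char_cone G (\<lambda>g. r * f g)"
| add: "char_cone G f \<Longrightarrow> char_cone G h \<Longrightarrow> char_cone G (\<lambda>g. f g + h g)"
| cong: "char_cone G f \<Longrightarrow> (\<And>g. g \<in> G \<Longrightarrow> h g = f g) \<Longrightarrow> char_cone G h"

lemma character_mult:
  "character G \<chi> \<Longrightarrow> character G \<psi> \<Longrightarrow> character G (\<lambda>g. \<chi> g * \<psi> g)"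
  unfolding character_def by (intro conjI ballI) (simp, force)

lemma char_cone_const: "r \<ge> 0 \<Longrightarrow> char_cone G (\<lambda>_. r)"
  using char_cone.scale[OF char_cone.char, of G "\<lambda>_. 1" r] by (simp add: character_def)

lemma char_cone_mult:
  assumes "char_cone G f" "char_cone G h"
  shows "char_cone G (\<lambda>g. f g * h g)"
  using assms(1)
proof induction
  case (char \<chi>)
  from assms(2) show ?case
  proof induction
    case (char \<psi>)
    then show ?case using \<open>character G \<chi>\<close> by (intro char_cone.char character_mult)
  next
    case (scale f r)
    show ?case
      by (rule char_cone.cong[OF char_cone.scale[OF scale.IH scale.hyps(2)]]) simp
  next
    case (add f h)
    show ?case by (rule char_cone.cong[OF char_cone.add[OF add.IH]]) (simp add: algebra_simps)
  next
    case (cong f h)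
    show ?case by (rule char_cone.cong[OF cong.IH]) (simp add: cong.hyps)
  qed
next
  case (scale f r)
  show ?case
    by (rule char_cone.cong[OF char_cone.scale[OF scale.IH scale.hyps(2)]]) simp
next
  case (add f h)
  show ?case by (rule char_cone.cong[OF char_cone.add[OF add.IH]]) (simp add: algebra_simps)
next
  case (cong f h)
  show ?case by (rule char_cone.cong[OF cong.IH]) (simp add: cong.hyps)
qed

lemma char_cone_prod:
  assumes "\<And>v. v \<in> V \<Longrightarrow> char_cone G (f v)"
  shows "char_cone G (\<lambda>g. \<Prod>v\<in>V. f v g)"
  using assms
  by (induction V rule: infinite_finite_induct) (auto intro: char_cone_const char_cone_mult)

locale involutive_group =
  fixes G :: "'g::comm_monoid_mult set"
  assumes fin: "finite G" and closed: "g \<in> G \<Longrightarrow> h \<in> G \<Longrightarrow> g * h \<in> G"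
    and invol: "g \<in> G \<Longrightarrow> g * g = 1"
begin

lemma translate_translate: "h \<in> G \<Longrightarrow> g * h * h = g"
  by (simp add: mult.assoc invol)

lemma sum_translate: "h \<in> G \<Longrightarrow> (\<Sum>g\<in>G. f (g * h)) = (\<Sum>g\<in>G. f g)"
  by (rule sum.reindex_bij_witness[of _ "\<lambda>g. g * h" "\<lambda>g. g * h"])
    (auto simp: translate_translate closed)

text \<open>A character with value -1 at some h changes sign under translation by h, so its sum
  vanishes; any other character is 1 throughout G.\<close>

lemma sum_char_cone_nonneg:
  assumes "char_cone G f"
  shows "(\<Sum>g\<in>G. f g) \<ge> 0"
  using assms
proof induction
  case (char \<chi>)
  show ?case
  proof (cases "\<exists>h\<in>G. \<chi> h = -1")
    case True
    then obtain h where h: "h \<in> G" "\<chi> h = -1" by blast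
    have "(\<Sum>g\<in>G. \<chi> g) = (\<Sum>g\<in>G. \<chi> (g * h))" by (rule sum_translate[OF h(1), symmetric])
    also have "\<dots> = (\<Sum>g\<in>G. - \<chi> g)"
      using char h by (intro sum.cong) (auto simp: character_def)
    finally show ?thesis by (simp add: sum_negf)
  next
    case False
    with char have "\<chi> g = 1" if "g \<in> G" for g using that by (auto simp: character_def)
    then show ?thesis by (intro sum_nonneg) auto
  qed
qed (auto simp: sum.distrib sum_distrib_left[symmetric])

text \<open>On a character the difference is (1 - \<chi> h) times \<chi>, and 1 - \<chi> h is 0 or
  2.\<close>

lemma char_cone_diff_translate:
  assumes "char_cone G f" "h \<in> G"
  shows "char_cone G (\<lambda>g. f g - f (g * h))"
  using assms(1)
proof induction
  case (char \<chi>)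
  have "1 - \<chi> h \<ge> 0" using char assms(2) by (auto simp: character_def)
  from char_cone.scale[OF char_cone.char[OF char] this] show ?case
    by (rule char_cone.cong) (use char assms(2) in \<open>auto simp: character_def algebra_simps\<close>)
next
  case (scale f r)
  show ?case
    by (rule char_cone.cong[OF char_cone.scale[OF scale.IH scale.hyps(2)]])
      (simp add: algebra_simps)
next
  case (add f h)
  show ?case by (rule char_cone.cong[OF char_cone.add[OF add.IH]]) simp
next
  case (cong f k)
  show ?case
    by (rule char_cone.cong[OF cong.IH]) (simp add: cong.hyps closed assms(2))
qed

text \<open>Ginibre's duplication: writing the second copy as g * h makes each factor, for fixed h,
  a nonnegative combination of characters in g.\<close>
lemma ginibre:
  fixes R F H :: "'g \<Rightarrow> real"
  assumes R: "\<And>h. h \<in> G \<Longrightarrow> char_cone G (\<lambda>g. R g * R (g * h))"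
    and F: "char_cone G F" and H: "char_cone G H"
  shows "(\<Sum>g\<in>G. R g * F g) * (\<Sum>g\<in>G. R g * H g) \<le> (\<Sum>g\<in>G. R g) * (\<Sum>g\<in>G. R g * F g * H g)"
proof -
  have "0 \<le> (\<Sum>h\<in>G. \<Sum>g\<in>G. R g * R (g * h) * ((F g - F (g * h)) * (H g - H (g * h))))"
    by (intro sum_nonneg sum_char_cone_nonneg char_cone_mult R char_cone_diff_translate F H)
  also have "\<dots> = (\<Sum>g\<in>G. \<Sum>h\<in>G. R g * R (h * g) * ((F g - F (h * g)) * (H g - H (h * g))))"
    by (subst sum.swap) (simp add: mult.commute)
  also have "\<dots> = (\<Sum>g\<in>G. \<Sum>h\<in>G. R g * R h * ((F g - F h) * (H g - H h)))"
    by (intro sum.cong refl sum_translate)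
  also have "\<dots> = (\<Sum>g\<in>G. \<Sum>h\<in>G. R g * F g * H g * R h) + (\<Sum>g\<in>G. \<Sum>h\<in>G. R g * (R h * F h * H h))
      - (\<Sum>g\<in>G. \<Sum>h\<in>G. (R g * F g) * (R h * H h)) - (\<Sum>g\<in>G. \<Sum>h\<in>G. (R g * H g) * (R h * F h))"
    unfolding sum.distrib[symmetric] sum_subtractf[symmetric]
    by (intro sum.cong refl) (simp add: algebra_simps)
  finally show ?thesis unfolding sum_product[symmetric] by (simp add: algebra_simps)
qed

section \<open>Log-supermodularity of partition functions in the set of finite couplings\<close>

lemma char_cone_affine:
  assumes "character G \<chi>" "p \<ge> 0" "q \<ge> 0"
  shows "char_cone G (\<lambda>g. p + q * \<chi> g)"
  by (intro char_cone.add char_cone_const char_cone.scale char_cone.char assms)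

lemma log_supermodular_disagreement_sum:
  fixes s :: "'v \<Rightarrow> 'g \<Rightarrow> real" and x :: "'v \<Rightarrow> real"
  assumes s: "\<And>v. v \<in> V \<Longrightarrow> character G (s v)"
    and x: "\<And>v. v \<in> V \<Longrightarrow> 0 \<le> x v \<and> x v \<le> 1"
  defines "Q \<equiv> \<lambda>A. \<Sum>g\<in>G. \<Prod>v\<in>V. (if s v g = 1 then 1 else if v \<in> A then x v else 0)"
  shows "Q A * Q B \<le> Q (A \<union> B) * Q (A \<inter> B)"
proof -
  define y where "y v = (if v \<in> A \<union> B then x v else 0)" for v
  have y: "0 \<le> y v" "y v \<le> 1" if "v \<in> V" for v using x[OF that] by (auto simp: y_def)
  \<comment> \<open>The affine form is 1 at sign 1 and y v at sign -1; y v \<le> 1 makes both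
    coefficients nonnegative.\<close>
  define R where "R g = (\<Prod>v\<in>V. (1 + y v) / 2 + (1 - y v) / 2 * s v g)" for g
  \<comment> \<open>The indicator that every sign off C is 1. Multiplying R by it lowers the weight
    of a disagreement off C to 0.\<close>
  define F where "F C g = (\<Prod>v\<in>V. if v \<in> C then 1 else 1 / 2 + 1 / 2 * s v g)" for C g
  have sgn: "s v g = 1 \<or> s v g = -1" if "v \<in> V" "g \<in> G" for v g
    using s[OF that(1)] that(2) by (auto simp: character_def)
  have "char_cone G (\<lambda>g. if v \<in> C then 1 else 1 / 2 + 1 / 2 * s v g)" if "v \<in> V" for v C
    using char_cone_affine[OF s[OF that], of "1/2" "1/2"] char_cone_const[of 1 G]
    by (cases "v \<in> C") auto
  then have F: "char_cone G (F C)" for C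
    unfolding F_def by (intro char_cone_prod)
  have R: "char_cone G (\<lambda>g. R g * R (g * h))" if h: "h \<in> G" for h
    unfolding R_def prod.distrib[symmetric]
  proof (rule char_cone_prod)
    fix v assume v: "v \<in> V"
    \<comment> \<open>If h preserves the sign at v, the factor is squared; if h flips it, the two
      factors are 1 and y v in some order, so their product is constant in g.\<close>
    from sgn[OF v h] consider "s v h = 1" | "s v h = -1" by blast
    then show "char_cone G (\<lambda>g. ((1 + y v) / 2 + (1 - y v) / 2 * s v g) *
        ((1 + y v) / 2 + (1 - y v) / 2 * s v (g * h)))"
    proof cases
      case 1
      have a: "char_cone G (\<lambda>g. (1 + y v) / 2 + (1 - y v) / 2 * s v g)"
        by (rule char_cone_affine[OF s[OF v]]) (use y[OF v] in auto)
      show ?thesis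
        by (rule char_cone.cong[OF char_cone_mult[OF a a]])
          (use s[OF v] h 1 in \<open>auto simp: character_def\<close>)
    next
      case 2
      show ?thesis
      proof (rule char_cone.cong[OF char_cone_const[of "y v"]])
        show "0 \<le> y v" using y[OF v] by simp
        fix g assume g: "g \<in> G"
        have "s v (g * h) = - s v g" using s[OF v] g h 2 by (auto simp: character_def)
        then show "((1 + y v) / 2 + (1 - y v) / 2 * s v g) *
            ((1 + y v) / 2 + (1 - y v) / 2 * s v (g * h)) = y v"
          using sgn[OF v g] by (auto simp: field_simps)
      qed
    qed
  qed
  have eq: "(\<Sum>g\<in>G. \<Prod>v\<in>V. k v g) = Q C"
    if "\<And>v g. v \<in> V \<Longrightarrow> s v g = 1 \<Longrightarrow> k v g = 1"
      "\<And>v g. v \<in> V \<Longrightarrow> s v g = -1 \<Longrightarrow> k v g = (if v \<in> C then x v else 0)" for k C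
    unfolding Q_def
  proof (intro sum.cong prod.cong refl)
    fix g v assume "g \<in> G" "v \<in> V"
    with sgn[OF this(2,1)] show "k v g = (if s v g = 1 then 1 else if v \<in> C then x v else 0)"
      using that[of v g] by auto
  qed
  have QA: "(\<Sum>g\<in>G. R g * F A g) = Q A"
    unfolding R_def F_def prod.distrib[symmetric] by (rule eq) (auto simp: y_def field_simps)
  have QB: "(\<Sum>g\<in>G. R g * F B g) = Q B"
    unfolding R_def F_def prod.distrib[symmetric] by (rule eq) (auto simp: y_def field_simps)
  have QI: "(\<Sum>g\<in>G. R g * F A g * F B g) = Q (A \<inter> B)"
    unfolding R_def F_def prod.distrib[symmetric] by (rule eq) (auto simp: y_def field_simps)
  have QU: "(\<Sum>g\<in>G. R g) = Q (A \<union> B)"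
    unfolding R_def by (rule eq) (auto simp: y_def field_simps)
  from ginibre[OF R F F, of A B] show ?thesis unfolding QA QB QU QI .
qed

end

section \<open>The four functions theorem and the FKG inequality\<close>

text \<open>The one-point case of the four functions theorem: index 1 means that the point is
  present, so both mixed products are bounded by the same c1 * d0.\<close>

lemma four_numbers:
  fixes a0 a1 b0 b1 c0 c1 d0 d1 :: real
  assumes nn: "a0 \<ge> 0" "a1 \<ge> 0" "b0 \<ge> 0" "b1 \<ge> 0" "c0 \<ge> 0" "c1 \<ge> 0" "d0 \<ge> 0" "d1 \<ge> 0"
    and 00: "a0 * b0 \<le> c0 * d0" and 01: "a0 * b1 \<le> c1 * d0"
    and 10: "a1 * b0 \<le> c1 * d0" and 11: "a1 * b1 \<le> c1 * d1"
  shows "(a0 + a1) * (b0 + b1) \<le> (c0 + c1) * (d0 + d1)"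
proof (cases "c1 * d0 = 0")
  case True
  then have "a0 * b1 = 0" "a1 * b0 = 0"
    using 01 10 nn mult_nonneg_nonneg[of a0 b1] mult_nonneg_nonneg[of a1 b0] by linarith+
  moreover have "0 \<le> c0 * d1" "0 \<le> c1 * d0" using nn by auto
  moreover have "(c0 + c1) * (d0 + d1) = c0 * d0 + c0 * d1 + c1 * d0 + c1 * d1"
    "(a0 + a1) * (b0 + b1) = a0 * b0 + a0 * b1 + a1 * b0 + a1 * b1" by (simp_all add: algebra_simps)
  ultimately show ?thesis using 00 11 by linarith
next
  case False
  define m where "m = c1 * d0"
  have m: "m > 0" using False nn by (simp add: m_def less_le)
  \<comment> \<open>Both mixed products are at most m. Expanding bounds their sum by m plus their
    product divided by m, and that product regroups into the two unmixed ones.\<close>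
  have "(m - a0 * b1) * (m - a1 * b0) \<ge> 0"
    using 01 10 by (simp add: m_def)
  then have "m * (a0 * b1 + a1 * b0) \<le> m * m + (a0 * b0) * (a1 * b1)"
    by (simp add: algebra_simps)
  also have "(a0 * b0) * (a1 * b1) \<le> (c0 * d0) * (c1 * d1)"
    by (rule mult_mono[OF 00 11]) (use nn in auto)
  also have "m * m + (c0 * d0) * (c1 * d1) = m * (c1 * d0 + c0 * d1)"
    by (simp add: m_def algebra_simps)
  finally have "a0 * b1 + a1 * b0 \<le> c1 * d0 + c0 * d1" using m by simp
  with 00 11 show ?thesis by (simp add: algebra_simps)
qed

lemma sum_Pow_insert:
  fixes f :: "'a set \<Rightarrow> real"
  assumes "finite A" "z \<notin> A"
  shows "(\<Sum>X\<in>Pow (insert z A). f X) = (\<Sum>X\<in>Pow A. f X + f (insert z X))"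
proof -
  have "inj_on (insert z) (Pow A)" using assms(2) by (auto simp: inj_on_def)
  moreover have "Pow A \<inter> insert z ` Pow A = {}" using assms(2) by auto
  ultimately show ?thesis using assms(1)
    by (simp add: Pow_insert sum.union_disjoint sum.reindex sum.distrib)
qed

text \<open>Induction on the ground set: summing over the presence of z leaves four functions on
  \<open>Pow A\<close>, and \<open>four_numbers\<close> gives their hypothesis.\<close>

lemma four_functions:
  fixes \<alpha> \<beta> \<gamma> \<delta> :: "'a set \<Rightarrow> real"
  assumes "finite A"
    and "\<And>X. X \<subseteq> A \<Longrightarrow> \<alpha> X \<ge> 0 \<and> \<beta> X \<ge> 0 \<and> \<gamma> X \<ge> 0 \<and> \<delta> X \<ge> 0"
    and "\<And>X Y. X \<subseteq> A \<Longrightarrow> Y \<subseteq> A \<Longrightarrow> \<alpha> X * \<beta> Y \<le> \<gamma> (X \<union> Y) * \<delta> (X \<inter> Y)"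
  shows "(\<Sum>X\<in>Pow A. \<alpha> X) * (\<Sum>X\<in>Pow A. \<beta> X) \<le> (\<Sum>X\<in>Pow A. \<gamma> X) * (\<Sum>X\<in>Pow A. \<delta> X)"
  using assms
proof (induction A arbitrary: \<alpha> \<beta> \<gamma> \<delta> rule: finite_induct)
  case empty
  then show ?case by simp
next
  case (insert z A)
  have sub: "X \<subseteq> insert z A" "insert z X \<subseteq> insert z A" if "X \<subseteq> A" for X using that by auto
  have nn: "\<alpha> X \<ge> 0" "\<beta> X \<ge> 0" "\<gamma> X \<ge> 0" "\<delta> X \<ge> 0" if "X \<subseteq> insert z A" for X
    using insert.prems(1)[OF that] by auto
  show ?case unfolding sum_Pow_insert[OF insert.hyps]
  proof (rule insert.IH)
    fix X assume "X \<subseteq> A"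
    from nn[OF sub(1)[OF this]] nn[OF sub(2)[OF this]]
    show "0 \<le> \<alpha> X + \<alpha> (insert z X) \<and> 0 \<le> \<beta> X + \<beta> (insert z X) \<and>
      0 \<le> \<gamma> X + \<gamma> (insert z X) \<and> 0 \<le> \<delta> X + \<delta> (insert z X)" by simp
  next
    fix X Y assume XY: "X \<subseteq> A" "Y \<subseteq> A"
    then have z: "z \<notin> X" "z \<notin> Y" "X \<union> Y \<subseteq> A" "X \<inter> Y \<subseteq> A" using insert.hyps by auto
    note le = insert.prems(2)
    have eqs: "insert z X \<union> Y = insert z (X \<union> Y)" "insert z X \<inter> Y = X \<inter> Y"
      "X \<union> insert z Y = insert z (X \<union> Y)" "X \<inter> insert z Y = X \<inter> Y"
      "insert z X \<union> insert z Y = insert z (X \<union> Y)" "insert z X \<inter> insert z Y = insert z (X \<inter> Y)"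
      using z by auto
    note x = sub[OF XY(1)] and y = sub[OF XY(2)] and u = sub[OF z(3)] and i = sub[OF z(4)]
    show "(\<alpha> X + \<alpha> (insert z X)) * (\<beta> Y + \<beta> (insert z Y)) \<le>
      (\<gamma> (X \<union> Y) + \<gamma> (insert z (X \<union> Y))) * (\<delta> (X \<inter> Y) + \<delta> (insert z (X \<inter> Y)))"
      using le[OF x(1) y(1)] le[OF x(1) y(2)] le[OF x(2) y(1)] le[OF x(2) y(2)]
      unfolding eqs
      by (rule four_numbers[OF nn(1)[OF x(1)] nn(1)[OF x(2)] nn(2)[OF y(1)] nn(2)[OF y(2)]
        nn(3)[OF u(1)] nn(3)[OF u(2)] nn(4)[OF i(1)] nn(4)[OF i(2)]])
  qed
qed

lemma FKG_inequality:
  fixes \<mu> f g :: "'a set \<Rightarrow> real"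
  assumes A: "finite A" and nn: "\<And>X. X \<subseteq> A \<Longrightarrow> \<mu> X \<ge> 0"
    and lattice: "\<And>X Y. X \<subseteq> A \<Longrightarrow> Y \<subseteq> A \<Longrightarrow> \<mu> X * \<mu> Y \<le> \<mu> (X \<union> Y) * \<mu> (X \<inter> Y)"
    and f: "\<And>X Y. X \<subseteq> Y \<Longrightarrow> Y \<subseteq> A \<Longrightarrow> f X \<le> f Y"
    and g: "\<And>X Y. X \<subseteq> Y \<Longrightarrow> Y \<subseteq> A \<Longrightarrow> g X \<le> g Y"
  shows "(\<Sum>X\<in>Pow A. f X * \<mu> X) * (\<Sum>X\<in>Pow A. g X * \<mu> X) \<le>
    (\<Sum>X\<in>Pow A. f X * g X * \<mu> X) * (\<Sum>X\<in>Pow A. \<mu> X)"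
proof -
  \<comment> \<open>Subtracting the minimum, attained at the empty set, makes both functions
    nonnegative, as \<open>four_functions\<close> demands; the covariance does not change.\<close>
  define f' where "f' X = f X - f {}" for X
  define g' where "g' X = g X - g {}" for X
  have f': "f' X \<ge> 0" and g': "g' X \<ge> 0" if "X \<subseteq> A" for X
    using f[of "{}" X] g[of "{}" X] that by (auto simp: f'_def g'_def)
  have "(\<Sum>X\<in>Pow A. f' X * \<mu> X) * (\<Sum>X\<in>Pow A. g' X * \<mu> X) \<le>
    (\<Sum>X\<in>Pow A. f' X * g' X * \<mu> X) * (\<Sum>X\<in>Pow A. \<mu> X)"
  proof (rule four_functions[OF A])
    fix X Y assume XY: "X \<subseteq> A" "Y \<subseteq> A"
    have "f' X * g' Y \<le> f' (X \<union> Y) * g' (X \<union> Y)"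
      by (rule mult_mono) (use XY f g f' g' in \<open>auto simp: f'_def g'_def\<close>)
    from mult_mono[OF this lattice[OF XY]]
    show "f' X * \<mu> X * (g' Y * \<mu> Y) \<le> f' (X \<union> Y) * g' (X \<union> Y) * \<mu> (X \<union> Y) * \<mu> (X \<inter> Y)"
      using XY f'[of "X \<union> Y"] g'[of "X \<union> Y"] nn by (simp add: mult_ac)
  qed (use f' g' nn in auto)
  note ineq = this
  have eqs: "(\<Sum>X\<in>Pow A. f' X * \<mu> X) = (\<Sum>X\<in>Pow A. f X * \<mu> X) - f {} * (\<Sum>X\<in>Pow A. \<mu> X)"
    "(\<Sum>X\<in>Pow A. g' X * \<mu> X) = (\<Sum>X\<in>Pow A. g X * \<mu> X) - g {} * (\<Sum>X\<in>Pow A. \<mu> X)"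
    "(\<Sum>X\<in>Pow A. f' X * g' X * \<mu> X) = (\<Sum>X\<in>Pow A. f X * g X * \<mu> X)
      - f {} * (\<Sum>X\<in>Pow A. g X * \<mu> X) - g {} * (\<Sum>X\<in>Pow A. f X * \<mu> X)
      + f {} * g {} * (\<Sum>X\<in>Pow A. \<mu> X)"
    unfolding sum_distrib_left sum_subtractf[symmetric] sum.distrib[symmetric]
    by (intro sum.cong refl; simp add: f'_def g'_def algebra_simps)+
  have *: "F * G \<le> H * M" if "(F - p * M) * (G - q * M) \<le> (H - p * G - q * F + p * q * M) * M"
    for F G H M p q :: real
  proof -
    have "(F - p * M) * (G - q * M) - (H - p * G - q * F + p * q * M) * M = F * G - H * M"
      by (simp add: algebra_simps)
    with that show ?thesis by linarith
  qed
  show ?thesis by (rule *[OF ineq[unfolded eqs]])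
qed

section \<open>Connectedness of the exterior of a simple cycle\<close>

definition cyc_next :: "vertex list \<Rightarrow> nat \<Rightarrow> vertex" where
  "cyc_next cyc k = cyc ! ((k + 1) mod length cyc)"

text \<open>A set of indices rather than a truth value, so that its cardinality can enter the parity
  counts of crossings.\<close>

definition edge_indices :: "vertex list \<Rightarrow> vertex \<Rightarrow> vertex \<Rightarrow> nat set" where
  "edge_indices cyc u w = {k. k < length cyc \<and>
     (cyc ! k = u \<and> cyc_next cyc k = w \<or> cyc ! k = w \<and> cyc_next cyc k = u)}"

text \<open>Junk unless u and w are adjacent.\<close>
definition edge_faces :: "vertex \<Rightarrow> vertex \<Rightarrow> face \<times> face" where
  "edge_faces u w =
     (if fst u = fst w
      then ((fst u, max (snd u) (snd w)), (fst u + 1, max (snd u) (snd w)))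
      else ((max (fst u) (fst w), snd u), (max (fst u) (fst w), snd u + 1)))"

definition separates :: "face set \<Rightarrow> vertex \<Rightarrow> vertex \<Rightarrow> bool" where
  "separates W u w \<longleftrightarrow> (fst (edge_faces u w) \<in> W) \<noteq> (snd (edge_faces u w) \<in> W)"

lemma bij_betw_mod_Suc:
  assumes "n > 0"
  shows "bij_betw (\<lambda>k. (k + 1) mod n) {..<n} {..<n::nat}"
proof -
  have "inj_on (\<lambda>k. (k + 1) mod n) {..<n}"
    by (auto simp: inj_on_def mod_Suc split: if_splits)
  moreover have "(\<lambda>k. (k + 1) mod n) ` {..<n} \<subseteq> {..<n}" using assms by auto
  ultimately show ?thesis
    by (simp add: bij_betw_def endo_inj_surj)
qed

text \<open>Modulo 2, the number of changes is the sum of s over both ends of all steps; the cyclic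
  shift of indices makes the two halves equal.\<close>

lemma even_card_changes:
  fixes s :: "vertex \<Rightarrow> bool"
  assumes "length cyc > 0"
  shows "even (card {k. k < length cyc \<and> s (cyc ! k) \<noteq> s (cyc_next cyc k)})"
proof -
  define n where "n = length cyc"
  have "(\<Sum>k<n. of_bool (s (cyc_next cyc k))) = (\<Sum>k<n. of_bool (s (cyc ! k)) :: nat)"
    unfolding cyc_next_def n_def[symmetric]
    by (rule sum.reindex_bij_betw[OF bij_betw_mod_Suc]) (use assms in \<open>simp add: n_def\<close>)
  then have "even (\<Sum>k<n. of_bool (s (cyc ! k)) + of_bool (s (cyc_next cyc k)) :: nat)"
    by (simp add: sum.distrib)
  then have "even (card {k \<in> {..<n}. odd (of_bool (s (cyc ! k)) + of_bool (s (cyc_next cyc k)) :: nat)})"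
    by (simp add: even_sum_iff)
  moreover have "{k \<in> {..<n}. odd (of_bool (s (cyc ! k)) + of_bool (s (cyc_next cyc k)) :: nat)} =
    {k. k < length cyc \<and> s (cyc ! k) \<noteq> s (cyc_next cyc k)}"
    by (auto simp: n_def)
  ultimately show ?thesis by simp
qed

section \<open>A simple cycle as the mod 2 boundary of the region it encloses\<close>

context
  fixes cyc :: "vertex list"
  assumes cyc: "simple_cycle cyc"
begin

lemma length_cyc: "length cyc \<ge> 3" and distinct_cyc: "distinct cyc"
  using cyc by (auto simp: simple_cycle_def)

lemma Suc_mod_length [simp]: "Suc k mod length cyc < length cyc" "cyc \<noteq> []"
  using length_cyc by (auto intro: mod_less_divisor)

lemma adjacent_cyc: "k < length cyc \<Longrightarrow> adjacent (cyc ! k) (cyc_next cyc k)"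
  using cyc by (auto simp: simple_cycle_def cyc_next_def)

text \<open>Distinct vertices leave only k = l or the closed walk of two steps, where k and l are
  each other's successor; length at least 3 excludes the latter.\<close>

lemma edge_index_unique:
  assumes "k \<in> edge_indices cyc u w" "l \<in> edge_indices cyc u w"
  shows "k = l"
proof -
  define n where "n = length cyc"
  have n: "n \<ge> 3" using length_cyc by (simp add: n_def)
  have eq: "cyc ! i = cyc ! j \<longleftrightarrow> i = j" if "i < n" "j < n" for i j
    using that distinct_cyc by (simp add: n_def nth_eq_iff_index_eq)
  have kl: "k < n" "l < n" "(k+1) mod n < n" "(l+1) mod n < n"
    using assms n by (simp_all add: edge_indices_def n_def)
  have "cyc ! k = cyc ! l \<or> (cyc ! k = cyc ! ((l+1) mod n) \<and> cyc ! ((k+1) mod n) = cyc ! l)"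
    using assms by (auto simp: edge_indices_def n_def cyc_next_def)
  then have "k = l \<or> (k = (l+1) mod n \<and> (k+1) mod n = l)" using eq kl by auto
  then show ?thesis using kl n by (auto simp: mod_Suc split: if_splits)
qed

lemma odd_card_edge_indices: "odd (card (edge_indices cyc u w)) \<longleftrightarrow> edge_indices cyc u w \<noteq> {}"
proof (cases "edge_indices cyc u w = {}")
  case False
  then obtain k where "k \<in> edge_indices cyc u w" by blast
  then have "edge_indices cyc u w = {k}" using edge_index_unique by blast
  then show ?thesis by simp
qed simp

text \<open>The rays from the two faces differ only in the edge between the faces, which a simple
  cycle uses at most once.\<close>

lemma separates_domain_vertical:
  "((p, q) \<in> domain_faces cyc) \<noteq> ((p + 1, q) \<in> domain_faces cyc) \<longleftrightarrow>
    edge_indices cyc (p, q - 1) (p, q) \<noteq> {}"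
proof -
  let ?X = "\<lambda>f. {k. k < length cyc \<and> crosses cyc k f}"
  have "?X (p, q) = ?X (p + 1, q) \<union> edge_indices cyc (p, q - 1) (p, q)"
    by (auto simp: crosses_def edge_indices_def cyc_next_def Let_def prod_eq_iff split: if_splits)
  moreover have "?X (p + 1, q) \<inter> edge_indices cyc (p, q - 1) (p, q) = {}"
    by (auto simp: crosses_def edge_indices_def cyc_next_def Let_def)
  ultimately have "card (?X (p, q)) = card (?X (p + 1, q)) + card (edge_indices cyc (p, q - 1) (p, q))"
    using card_Un_disjoint[of "?X (p + 1, q)" "edge_indices cyc (p, q - 1) (p, q)"]
    by (simp add: edge_indices_def)
  then show ?thesis
    using odd_card_edge_indices by (simp add: domain_faces_def) blast
qed

lemma separates_domain_horizontal:
  "((p, q) \<in> domain_faces cyc) \<noteq> ((p, q + 1) \<in> domain_faces cyc) \<longleftrightarrow>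
    edge_indices cyc (p - 1, q) (p, q) \<noteq> {}"
proof -
  let ?X = "\<lambda>f. {k. k < length cyc \<and> crosses cyc k f}"
  \<comment> \<open>The half-line of vertices that runs to the right between the two rays. The cycle
    enters or leaves it by an edge crossing the lower ray, by one crossing the upper ray, or through
    its end by the edge in question; the total is even.\<close>
  define s where "s v \<longleftrightarrow> snd v = q \<and> fst v \<ge> p" for v :: vertex
  let ?E = "edge_indices cyc (p - 1, q) (p, q)"
  have "{k. k < length cyc \<and> s (cyc ! k) \<noteq> s (cyc_next cyc k)} = (?X (p, q) \<union> ?X (p, q + 1)) \<union> ?E"
  proof -
    have "(s (cyc ! k) \<noteq> s (cyc_next cyc k)) \<longleftrightarrow>
      crosses cyc k (p, q) \<or> crosses cyc k (p, q + 1) \<or>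
      (cyc ! k = (p - 1, q) \<and> cyc_next cyc k = (p, q) \<or> cyc ! k = (p, q) \<and> cyc_next cyc k = (p - 1, q))"
      if "k < length cyc" for k
    proof -
      obtain x y x' y' where e: "cyc ! k = (x, y)" "cyc_next cyc k = (x', y')" by fastforce
      have "\<bar>x - x'\<bar> + \<bar>y - y'\<bar> = 1"
        using adjacent_cyc[OF that] e by (simp add: adjacent_def)
      then have "(x' = x + 1 \<and> y' = y) \<or> (x' = x - 1 \<and> y' = y) \<or> (x' = x \<and> y' = y + 1) \<or> (x' = x \<and> y' = y - 1)"
        by arith
      then show ?thesis
        unfolding s_def crosses_def cyc_next_def[symmetric] Let_def e
        by (elim disjE) (auto simp: min_def)
    qed
    then show ?thesis by (auto simp: edge_indices_def)
  qed
  moreover have "?X (p, q) \<inter> ?X (p, q + 1) = {}"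
    by (auto simp: crosses_def Let_def)
  moreover have "(?X (p, q) \<union> ?X (p, q + 1)) \<inter> ?E = {}"
  proof -
    have "?X f \<subseteq> {k. fst (cyc ! k) = fst (cyc_next cyc k)}" for f
      by (auto simp: crosses_def cyc_next_def Let_def)
    moreover have "?E \<inter> {k. fst (cyc ! k) = fst (cyc_next cyc k)} = {}"
      by (auto simp: edge_indices_def)
    ultimately show ?thesis by blast
  qed
  moreover have "finite ?E" by (simp add: edge_indices_def)
  ultimately have "even (card (?X (p, q)) + card (?X (p, q + 1)) + card ?E)"
    using even_card_changes[of cyc s] length_cyc
    by (simp add: card_Un_disjoint)
  then show ?thesis
    using odd_card_edge_indices by (simp add: domain_faces_def)
qed

lemma edge_indices_sym: "edge_indices cyc u w = edge_indices cyc w u"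
  by (auto simp: edge_indices_def)

lemma separates_sym: "adjacent u w \<Longrightarrow> separates W u w = separates W w u"
  by (cases "snd u = snd w") (auto simp: separates_def edge_faces_def max.commute adjacent_def)

lemma adjacent_cases:
  assumes "adjacent u w"
  obtains "w = (fst u + 1, snd u)" | "w = (fst u - 1, snd u)"
    | "w = (fst u, snd u + 1)" | "w = (fst u, snd u - 1)"
proof -
  have "(fst w = fst u + 1 \<and> snd w = snd u) \<or> (fst w = fst u - 1 \<and> snd w = snd u) \<or>
    (fst w = fst u \<and> snd w = snd u + 1) \<or> (fst w = fst u \<and> snd w = snd u - 1)"
    using assms unfolding adjacent_def by arith
  then show ?thesis using that by (metis prod.collapse)
qed

text \<open>The parity definition of enclosure flips exactly across the edges of the cycle. This is
  the link between cycle and region used in the proof that the exterior is connected.\<close>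

lemma separates_domain:
  assumes "adjacent u w"
  shows "separates (domain_faces cyc) u w \<longleftrightarrow> edge_indices cyc u w \<noteq> {}"
  using assms
proof (cases rule: adjacent_cases)
  case 1
  then show ?thesis using separates_domain_horizontal[of "fst u + 1" "snd u"]
    by (simp add: separates_def edge_faces_def)
next
  case 2
  then show ?thesis using separates_domain_horizontal[of "fst u" "snd u"] edge_indices_sym[of u w]
    by (simp add: separates_def edge_faces_def)
next
  case 3
  then show ?thesis using separates_domain_vertical[of "fst u" "snd u + 1"]
    by (simp add: separates_def edge_faces_def)
next
  case 4
  then show ?thesis using separates_domain_vertical[of "fst u" "snd u"] edge_indices_sym[of u w]
    by (simp add: separates_def edge_faces_def)
qed

text \<open>The equivalence of the two equalities says that an even number of the four edges at (i,
  j) separate W: membership changes evenly often on a tour of the four surrounding faces.\<close>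

lemma separates_even_degree:
  fixes i j :: int
  shows "(separates W (i, j) (i + 1, j) = separates W (i, j) (i - 1, j)) \<longleftrightarrow>
         (separates W (i, j) (i, j + 1) = separates W (i, j) (i, j - 1))"
  by (auto simp: separates_def edge_faces_def)

lemma cyc_nth_eq_iff: "i < length cyc \<Longrightarrow> j < length cyc \<Longrightarrow> cyc ! i = cyc ! j \<longleftrightarrow> i = j"
  using distinct_cyc by (simp add: nth_eq_iff_index_eq)

text \<open>Each vertex has an even number of separating edges, so if these lie on the cycle then both
  or neither of the two cycle edges at a vertex are separating.\<close>
lemma separates_next:
  assumes W: "\<And>u w. adjacent u w \<Longrightarrow> separates W u w \<Longrightarrow> separates (domain_faces cyc) u w"
    and k: "k < length cyc"
  defines "l \<equiv> (k + 1) mod length cyc"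
  shows "separates W (cyc ! k) (cyc_next cyc k) \<longleftrightarrow> separates W (cyc ! l) (cyc_next cyc l)"
proof -
  have l: "l < length cyc" "cyc_next cyc k = cyc ! l" 
    using k by (auto simp: l_def cyc_next_def intro: mod_less_divisor)
  obtain i j where q: "cyc ! l = (i, j)" by fastforce
  define r where "r = cyc ! k"
  define t where "t = cyc_next cyc l"
  \<comment> \<open>Predecessor and successor on the cycle differ because its length is at least
    3.\<close>
  have rt: "r \<noteq> t"
    unfolding r_def t_def cyc_next_def using k length_cyc
    by (subst cyc_nth_eq_iff) (auto simp: l_def mod_Suc)
  have adj: "adjacent (i, j) t" "adjacent r (i, j)" "adjacent (i, j) r"
    using adjacent_cyc[OF l(1)] adjacent_cyc[OF k] l q by (auto simp: r_def t_def adjacent_def abs_minus_commute)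
  have only: "\<not> separates W (i, j) w" if w: "adjacent (i, j) w" "w \<noteq> r" "w \<noteq> t" for w
  proof
    assume "separates W (i, j) w"
    then have "edge_indices cyc (i, j) w \<noteq> {}" using W separates_domain w by blast
    then obtain m where m: "m < length cyc"
      "cyc ! m = (i, j) \<and> cyc_next cyc m = w \<or> cyc ! m = w \<and> cyc_next cyc m = (i, j)"
      by (auto simp: edge_indices_def)
    from m(2) show False
    proof
      assume "cyc ! m = (i, j) \<and> cyc_next cyc m = w"
      then have "m = l" using cyc_nth_eq_iff[OF m(1) l(1)] q by simp
      then show False using w \<open>cyc ! m = (i, j) \<and> cyc_next cyc m = w\<close> t_def by simp
    next
      assume *: "cyc ! m = w \<and> cyc_next cyc m = (i, j)"
      then have "(m + 1) mod length cyc = l"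
        using cyc_nth_eq_iff[of "(m+1) mod length cyc" l] l m(1) q
        by (auto simp: cyc_next_def intro: mod_less_divisor)
      then have "m = k" using m(1) k by (auto simp: l_def mod_Suc split: if_splits)
      then show False using w * r_def by simp
    qed
  qed
  have "separates W (i, j) r = separates W (i, j) t"
    using separates_even_degree[of W i j] rt only[of "(i+1,j)"] only[of "(i-1,j)"]
      only[of "(i,j+1)"] only[of "(i,j-1)"]
    by (cases rule: adjacent_cases[OF adj(1)]; cases rule: adjacent_cases[OF adj(3)])
      (auto simp: adjacent_def)
  then show ?thesis
    using separates_sym[OF adj(2)] l q by (simp add: r_def t_def)
qed

lemma separates_all_or_none:
  assumes W: "\<And>u w. adjacent u w \<Longrightarrow> separates W u w \<Longrightarrow> separates (domain_faces cyc) u w"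
    and "k < length cyc" "l < length cyc"
  shows "separates W (cyc ! k) (cyc_next cyc k) \<longleftrightarrow> separates W (cyc ! l) (cyc_next cyc l)"
proof -
  have "separates W (cyc ! k) (cyc_next cyc k) \<longleftrightarrow> separates W (cyc ! 0) (cyc_next cyc 0)"
    if "k < length cyc" for k using that
  proof (induction k)
    case (Suc k)
    then show ?case using separates_next[of W k] W by simp
  qed simp
  then show ?thesis using assms by blast
qed

lemma constant_if_no_separation:
  assumes "\<And>u w. adjacent u w \<Longrightarrow> \<not> separates W u w"
  shows "f \<in> W \<longleftrightarrow> g \<in> W"
proof -
  have h: "(i, j) \<in> W \<longleftrightarrow> (i + 1, j) \<in> W" for i j
    using assms[of "(i, j - 1)" "(i, j)"] by (simp add: separates_def edge_faces_def adjacent_def)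
  have v: "(i, j) \<in> W \<longleftrightarrow> (i, j + 1) \<in> W" for i j
    using assms[of "(i - 1, j)" "(i, j)"] by (simp add: separates_def edge_faces_def adjacent_def)
  have h': "(i, j) \<in> W \<longleftrightarrow> (0, j) \<in> W" for i j
  proof (induction i rule: int_induct[where k = 0])
    case (step1 i)
    then show ?case using h[of i j] by simp
  next
    case (step2 i)
    then show ?case using h[of "i - 1" j] by simp
  qed simp
  have v': "(0, j) \<in> W \<longleftrightarrow> (0, 0) \<in> W" for j
  proof (induction j rule: int_induct[where k = 0])
    case (step1 j)
    then show ?case using v[of 0 j] by simp
  next
    case (step2 j)
    then show ?case using v[of 0 "j - 1"] by simp
  qed simp
  show ?thesis using h' v' by (metis prod.collapse)
qed

text \<open>Adjacent exterior faces agree about W, so only cycle edges can separate it, and then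
  either none or all of them do. If none, W is constant over all faces. If all, W and the disjoint
  domain have the same boundary, so their union is constant. In both cases f0 shows that the
  constant set is empty.\<close>

lemma complement_connected:
  assumes disj: "W \<inter> domain_faces cyc = {}" and f0: "f0 \<notin> W" "f0 \<notin> domain_faces cyc"
    and h: "\<And>i j. (i, j) \<notin> domain_faces cyc \<Longrightarrow> (i + 1, j) \<notin> domain_faces cyc \<Longrightarrow>
                  (i, j) \<in> W \<longleftrightarrow> (i + 1, j) \<in> W"
    and v: "\<And>i j. (i, j) \<notin> domain_faces cyc \<Longrightarrow> (i, j + 1) \<notin> domain_faces cyc \<Longrightarrow>
                  (i, j) \<in> W \<longleftrightarrow> (i, j + 1) \<in> W"
  shows "W = {}"
proof -
  let ?D = "domain_faces cyc"
  have W: "separates ?D u w" if "adjacent u w" "separates W u w" for u w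
    using that(1)
  proof (cases rule: adjacent_cases)
    case 1
    then show ?thesis using that(2) v[of "fst u + 1" "snd u"] disj
      by (simp add: separates_def edge_faces_def) blast
  next
    case 2
    then show ?thesis using that(2) v[of "fst u" "snd u"] disj
      by (simp add: separates_def edge_faces_def) blast
  next
    case 3
    then show ?thesis using that(2) h[of "fst u" "snd u + 1"] disj
      by (simp add: separates_def edge_faces_def) blast
  next
    case 4
    then show ?thesis using that(2) h[of "fst u" "snd u"] disj
      by (simp add: separates_def edge_faces_def) blast
  qed
  have unseparated: "\<not> separates X u w"
    if adj: "adjacent u w" and X: "separates X u w \<Longrightarrow> separates ?D u w"
      and none: "\<And>k. k < length cyc \<Longrightarrow> \<not> separates X (cyc ! k) (cyc_next cyc k)" for X u w
  proof
    assume sep: "separates X u w"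
    then obtain k where "k \<in> edge_indices cyc u w" using X separates_domain[OF adj] by blast
    then show False using separates_sym[OF adj, of X] none sep by (auto simp: edge_indices_def)
  qed
  have eq0: "separates W (cyc ! k) (cyc_next cyc k) \<longleftrightarrow> separates W (cyc ! 0) (cyc_next cyc 0)"
    if "k < length cyc" for k
    using separates_all_or_none[of W k 0] W that by simp
  show ?thesis
  proof (cases "separates W (cyc ! 0) (cyc_next cyc 0)")
    case False
    then have "\<not> separates W u w" if "adjacent u w" for u w
      using unseparated[of u w W] W eq0 that by metis
    then show ?thesis using constant_if_no_separation[of W f0] f0 by blast
  next
    case True
    define X where "X = W \<union> ?D"
    have X: "separates X u w \<longleftrightarrow> (separates W u w \<noteq> separates ?D u w)" for u w
      using disj by (auto simp: separates_def X_def)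
    have "\<not> separates X u w" if "adjacent u w" for u w
    proof (rule unseparated[OF that])
      show "separates ?D u w" if "separates X u w"
        using that W[OF \<open>adjacent u w\<close>] X by blast
      show "\<not> separates X (cyc ! k) (cyc_next cyc k)" if "k < length cyc" for k
        using eq0[OF that] True W[OF adjacent_cyc[OF that]] X by blast
    qed
    then have "X = {}" using constant_if_no_separation[of X f0] f0 X_def by blast
    then show ?thesis by (simp add: X_def)
  qed
qed

lemma finite_domain_faces: "finite (domain_faces cyc)"
proof -
  define N where "N = (\<Sum>v\<in>set cyc. \<bar>fst v\<bar> + \<bar>snd v\<bar>)"
  have N: "\<bar>fst v\<bar> \<le> N" "\<bar>snd v\<bar> \<le> N" if "v \<in> set cyc" for v
    using member_le_sum[OF that, of "\<lambda>v. \<bar>fst v\<bar> + \<bar>snd v\<bar>"] by (auto simp: N_def)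
  have bounds: "\<bar>fst (cyc ! k)\<bar> \<le> N" "\<bar>snd (cyc ! k)\<bar> \<le> N"
    "\<bar>fst (cyc_next cyc k)\<bar> \<le> N" "\<bar>snd (cyc_next cyc k)\<bar> \<le> N" if "k < length cyc" for k
    using N[of "cyc ! k"] N[of "cyc_next cyc k"] that
    by (auto simp: cyc_next_def intro!: nth_mem mod_less_divisor)
  have "f \<in> {- N..N} \<times> {- N..N+1}" if "f \<in> domain_faces cyc" for f
  proof -
    let ?X = "{k. k < length cyc \<and> crosses cyc k f}"
    have odd: "odd (card ?X)" using that by (simp add: domain_faces_def)
    then have "?X \<noteq> {}" by (metis card.empty even_zero)
    then obtain k where k: "k < length cyc" "crosses cyc k f" by blast
    have 1: "fst f \<le> N" "- N \<le> snd f" "snd f \<le> N + 1"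
      using bounds[OF k(1)] k(2) unfolding crosses_def cyc_next_def[symmetric] Let_def by (auto simp: min_def split: if_splits)
    have "- N \<le> fst f"
    proof (rule ccontr)
      assume less: "\<not> - N \<le> fst f"
      \<comment> \<open>To the left of the whole cycle the ray misses nothing: its crossings are all
        the changes of side of a horizontal line, so their number is even.\<close>
      have "(k < length cyc \<and> (snd (cyc ! k) \<ge> snd f) \<noteq> (snd (cyc_next cyc k) \<ge> snd f)) \<longleftrightarrow>
        k < length cyc \<and> crosses cyc k f" for k
      proof (cases "k < length cyc")
        case True
        show ?thesis
          using adjacent_cyc[OF True] bounds[OF True] less True
          unfolding crosses_def cyc_next_def[symmetric] Let_def
          by (elim adjacent_cases) (auto simp: min_def)
      qed simp
      then have "even (card ?X)" using even_card_changes[of cyc "\<lambda>v. snd v \<ge> snd f"] length_cyc by simp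
      then show False using odd by simp
    qed
    with 1 show ?thesis by (cases f) auto
  qed
  then show ?thesis by (meson finite_SigmaI finite_atLeastAtMost_int finite_subset subsetI)
qed

end

section \<open>Splitting the odd spins\<close>

declare split_paired_All [simp del] split_paired_Ex [simp del]

text \<open>A vertex and its south-west face carry the same coordinates, so
  \<open>even_face v\<close> decides which diagonal at v is the even one.\<close>

definition even1 :: "vertex \<Rightarrow> face" where "even1 v = (if even_face v then SW v else NW v)"
definition even2 :: "vertex \<Rightarrow> face" where "even2 v = (if even_face v then NE v else SE v)"
definition odd1 :: "vertex \<Rightarrow> face" where "odd1 v = (if even_face v then NW v else SW v)"
definition odd2 :: "vertex \<Rightarrow> face" where "odd2 v = (if even_face v then SE v else NE v)"

lemmas corner_defs = even1_def even2_def odd1_def odd2_def SW_def SE_def NW_def NE_def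

lemma parity_corners [simp]:
  "even_face (even1 v)" "even_face (even2 v)" "\<not> even_face (odd1 v)" "\<not> even_face (odd2 v)"
  by (auto simp: corner_defs even_face_def)

lemma domain_vertices_iff:
  "v \<in> domain_vertices cyc \<longleftrightarrow>
    even1 v \<in> domain_faces cyc \<or> even2 v \<in> domain_faces cyc \<or>
    odd1 v \<in> domain_faces cyc \<or> odd2 v \<in> domain_faces cyc"
  unfolding domain_vertices_def even1_def even2_def odd1_def odd2_def by auto

lemma finite_domain_vertices:
  assumes "simple_cycle cyc"
  shows "finite (domain_vertices cyc)"
proof -
  let ?D = "domain_faces cyc"
  have "domain_vertices cyc \<subseteq> SW -` ?D \<union> SE -` ?D \<union> NW -` ?D \<union> NE -` ?D"
    by (auto simp: domain_vertices_def)
  moreover have "inj SW" "inj SE" "inj NW" "inj NE"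
    by (auto simp: inj_on_def SW_def SE_def NW_def NE_def prod_eq_iff)
  ultimately show ?thesis
    using finite_domain_faces[OF assms] by (meson finite_UnI finite_subset finite_vimageI)
qed

text \<open>Even faces are frozen at 1 so that these functions form a group under pointwise
  multiplication, with unit 1 and every element its own inverse. The value 1 off D is the boundary
  condition.\<close>

definition odd_configs :: "face set \<Rightarrow> (face \<Rightarrow> int) set" where
  "odd_configs D = {\<omega>. (\<forall>f. \<omega> f = 1 \<or> \<omega> f = -1) \<and> (\<forall>f. even_face f \<or> f \<notin> D \<longrightarrow> \<omega> f = 1)}"

definition agree :: "(face \<Rightarrow> int) \<Rightarrow> vertex \<Rightarrow> bool" where
  "agree \<omega> v \<longleftrightarrow> \<omega> (odd1 v) = \<omega> (odd2 v)"

lemma odd_configs_sign: "\<omega> \<in> odd_configs D \<Longrightarrow> \<omega> f = 1 \<or> \<omega> f = -1"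
  and odd_configs_one: "\<omega> \<in> odd_configs D \<Longrightarrow> even_face f \<or> f \<notin> D \<Longrightarrow> \<omega> f = 1"
  by (auto simp: odd_configs_def)

lemma odd_configs_mult: "\<omega> \<in> odd_configs D \<Longrightarrow> \<theta> \<in> odd_configs D \<Longrightarrow> \<omega> * \<theta> \<in> odd_configs D"
  unfolding odd_configs_def times_fun_def by (simp, metis mult_1 mult_minus1 minus_minus)

lemma odd_configs_square: "\<omega> \<in> odd_configs D \<Longrightarrow> \<omega> * \<omega> = 1"
proof
  fix f assume "\<omega> \<in> odd_configs D"
  from odd_configs_sign[OF this, of f] show "(\<omega> * \<omega>) f = 1 f" by auto
qed

lemma finite_odd_configs:
  assumes "finite D"
  shows "finite (odd_configs D)"
proof (rule inj_on_finite[where B = "Pow D"])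
  show "inj_on (\<lambda>\<omega>. {f \<in> D. \<omega> f = 1}) (odd_configs D)"
  proof (rule inj_onI, rule ext)
    fix \<omega> \<theta> f assume *: "\<omega> \<in> odd_configs D" "\<theta> \<in> odd_configs D" "{f \<in> D. \<omega> f = 1} = {f \<in> D. \<theta> f = 1}"
    then have "f \<in> D \<Longrightarrow> \<omega> f = 1 \<longleftrightarrow> \<theta> f = 1" by blast
    then show "\<omega> f = \<theta> f"
      using odd_configs_sign[OF *(1), of f] odd_configs_sign[OF *(2), of f]
        odd_configs_one[OF *(1), of f] odd_configs_one[OF *(2), of f] by metis
  qed
qed (use assms in auto)

lemma involutive_group_odd_configs: "finite D \<Longrightarrow> involutive_group (odd_configs D)"
  by unfold_locales (auto simp: finite_odd_configs odd_configs_mult odd_configs_square)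

lemma agree_mult_iff:
  assumes "\<omega> \<in> odd_configs D" "\<theta> \<in> odd_configs D"
  shows "agree (\<omega> * \<theta>) v \<longleftrightarrow> (agree \<omega> v \<longleftrightarrow> agree \<theta> v)"
  using odd_configs_sign[OF assms(1), of "odd1 v"] odd_configs_sign[OF assms(1), of "odd2 v"]
    odd_configs_sign[OF assms(2), of "odd1 v"] odd_configs_sign[OF assms(2), of "odd2 v"]
  by (auto simp: agree_def)

lemma agree_outside: "\<omega> \<in> odd_configs (domain_faces cyc) \<Longrightarrow> v \<notin> domain_vertices cyc \<Longrightarrow> agree \<omega> v"
  by (auto simp: agree_def domain_vertices_iff odd_configs_one)

text \<open>Agreement carries the spin of an odd face along its diagonal, which leaves the finite
  set D and reaches a face with spin 1.\<close>

lemma odd_config_trivial: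
  assumes D: "finite D" and \<omega>: "\<omega> \<in> odd_configs D" and agree: "\<And>v. agree \<omega> v"
  shows "\<omega> = 1"
proof
  fix f
  show "\<omega> f = 1 f"
  proof (cases "even_face f")
    case False
    obtain i j where f: "f = (i, j)" by fastforce
    have eq: "\<omega> (i + int n, j + int n) = \<omega> f" for n
    proof (induction n)
      case (Suc n)
      have "\<not> even_face (i + int n, j + int n)" using False f by (simp add: even_face_def)
      then show ?case
        using agree[of "(i + int n, j + int n)"] Suc by (simp add: agree_def corner_defs ac_simps)
    qed (simp add: f)
    have "inj (\<lambda>n. (i + int n, j + int n))" by (auto simp: inj_on_def)
    then have "\<not> range (\<lambda>n. (i + int n, j + int n)) \<subseteq> D"
      using D finite_subset finite_imageD[of "\<lambda>n. (i + int n, j + int n)" UNIV] infinite_UNIV_nat by blast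
    then obtain n where "(i + int n, j + int n) \<notin> D" by blast
    then show ?thesis using eq[of n] odd_configs_one[OF \<omega>] by simp
  qed (simp add: odd_configs_one[OF \<omega>])
qed

text \<open>The disagreement edges of \<omega> form an even subgraph of the lattice of even faces in which no
  edge joins the two classes of Q, so each class carries an even subgraph, which is again the
  disagreement set of a configuration because the plane is simply connected. That this
  configuration is 1 outside the domain needs the exterior of the cycle to be connected.\<close>
lemma odd_config_restrict:
  assumes cyc: "simple_cycle cyc" and \<omega>: "\<omega> \<in> odd_configs (domain_faces cyc)"
    and Q: "\<And>v. \<not> agree \<omega> v \<Longrightarrow> Q (even1 v) \<longleftrightarrow> Q (even2 v)"
  shows "\<exists>\<theta>\<in>odd_configs (domain_faces cyc).
    \<forall>v. agree \<theta> v \<longleftrightarrow> agree \<omega> v \<or> \<not> (Q (even1 v) \<and> Q (even2 v))"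
proof -
  let ?D = "domain_faces cyc"
  note sgn = odd_configs_sign[OF \<omega>]
  \<comment> \<open>The prescribed gradient of the configuration sought: the gradient of \<omega> on
    edges inside Q, and 1 elsewhere.\<close>
  define h where "h v = (if Q (even1 v) \<and> Q (even2 v) then \<omega> (odd1 v) * \<omega> (odd2 v) else 1)" for v
  have h_sgn: "h v = 1 \<or> h v = -1" for v
    using sgn[of "odd1 v"] sgn[of "odd2 v"] by (auto simp: h_def)
  have h_Q: "h v = (if Q e then \<omega> (odd1 v) * \<omega> (odd2 v) else 1)"
    if "e = even1 v \<or> e = even2 v" for v e
    using that Q[of v] sgn[of "odd1 v"] sgn[of "odd2 v"] by (auto simp: h_def agree_def)
  obtain K where K: "f \<in> ?D \<Longrightarrow> fst f < K" for f
  proof -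
    have "f \<in> ?D \<Longrightarrow> fst f < Max (insert 0 (fst ` ?D)) + 1" for f
      using finite_domain_faces[OF cyc] by (simp add: less_le_trans le_imp_less_Suc)
    then show ?thesis using that by blast
  qed
  have h_far: "h v = 1" if "fst v \<ge> K" for v
  proof -
    have "odd1 v \<notin> ?D" "odd2 v \<notin> ?D"
      using K[of "odd1 v"] K[of "odd2 v"] that by (auto simp: corner_defs split: if_splits)
    then show ?thesis by (simp add: h_def odd_configs_one[OF \<omega>])
  qed
  \<comment> \<open>The potential of h, integrated along the diagonal from f up to abscissa K; from
    there on h is 1.\<close>
  define \<phi> where "\<phi> f = (\<Prod>n<nat (K - fst f). h (fst f + int n, snd f + int n))" for f
  have \<phi>_sgn: "\<phi> f = 1 \<or> \<phi> f = -1" for f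
  proof -
    have "(\<Prod>n<m. h (fst f + int n, snd f + int n)) \<in> {1, -1}" for m
    proof (induction m)
      case (Suc m)
      then show ?case using h_sgn[of "(fst f + int m, snd f + int m)"] by auto
    qed simp
    then show ?thesis by (auto simp: \<phi>_def)
  qed
  have \<phi>_far: "\<phi> f = 1" if "fst f \<ge> K" for f using that by (simp add: \<phi>_def)
  have \<phi>_step: "\<phi> (i, j) = h (i, j) * \<phi> (i + 1, j + 1)" for i j
  proof (cases "i < K")
    case True
    then have "nat (K - i) = Suc (nat (K - (i + 1)))" by simp
    then show ?thesis
      by (simp add: \<phi>_def prod.lessThan_Suc_shift ac_simps del: prod.lessThan_Suc)
  qed (simp add: \<phi>_far h_far)
  \<comment> \<open>Zero curl around the even face ?e. Whether h at its four vertices is the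
    gradient of \<omega> depends on \<open>Q ?e\<close> alone, and then each of the four odd
    neighbours occurs twice.\<close>
  have h_closed: "h (i, j) * h (i + 1, j) * h (i, j + 1) * h (i + 1, j + 1) = 1"
    if "even (i + j)" for i j
  proof -
    let ?e = "(i + 1, j + 1)"
    have "h (i, j) = (if Q ?e then \<omega> (i, j + 1) * \<omega> (i + 1, j) else 1)"
      "h (i + 1, j) = (if Q ?e then \<omega> (i + 1, j) * \<omega> (i + 2, j + 1) else 1)"
      "h (i, j + 1) = (if Q ?e then \<omega> (i, j + 1) * \<omega> (i + 1, j + 2) else 1)"
      "h (i + 1, j + 1) = (if Q ?e then \<omega> (i + 1, j + 2) * \<omega> (i + 2, j + 1) else 1)"
      using that by (subst h_Q[of ?e]; simp add: corner_defs even_face_def ac_simps)+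
    then show ?thesis
      using sgn[of "(i, j + 1)"] sgn[of "(i + 1, j)"] sgn[of "(i + 2, j + 1)"] sgn[of "(i + 1, j + 2)"]
      by auto
  qed
  \<comment> \<open>Gradients across the other diagonal do not hold by construction. They are
    carried leftwards from abscissa K, one even face at a time, by \<open>h_closed\<close>.\<close>
  have \<phi>_cross: "\<phi> (i, j + 1) * \<phi> (i + 1, j) = h (i, j)" if "even (i + j)" for i j
    using that
  proof (induction "nat (K - i)" arbitrary: i j)
    case 0
    then show ?case by (simp add: \<phi>_far h_far)
  next
    case (Suc n)
    have "\<phi> (i + 1, j + 2) * \<phi> (i + 2, j + 1) = h (i + 1, j + 1)"
      using Suc(1)[of "i + 1" "j + 1"] Suc(2,3) by (simp add: ac_simps)
    then have "\<phi> (i, j + 1) * \<phi> (i + 1, j) = h (i, j + 1) * h (i + 1, j) * h (i + 1, j + 1)"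
      using \<phi>_step[of i "j + 1"] \<phi>_step[of "i + 1" j] by (simp add: ac_simps)
    also have "\<dots> = h (i, j)"
      using h_closed[OF Suc(3)] h_sgn[of "(i, j)"] by (auto simp: ac_simps)
    finally show ?case .
  qed
  have \<phi>_gradient: "\<phi> (odd1 v) * \<phi> (odd2 v) = h v" for v
  proof (cases v)
    case (Pair i j)
    show ?thesis
    proof (cases "even_face v")
      case True
      then show ?thesis using \<phi>_cross[of i j] Pair by (simp add: corner_defs even_face_def)
    next
      case False
      then show ?thesis using \<phi>_step[of i j] \<phi>_sgn[of "(i + 1, j + 1)"] Pair
        by (auto simp: corner_defs)
    qed
  qed
  \<comment> \<open>Around an even face e the potential moves like \<omega> if \<open>Q e\<close>
    holds and is constant otherwise, so \<open>\<rho> e\<close> is constant on the four odd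
    neighbours of e. Giving e this common value extends \<phi> to \<psi>. Off the domain \<omega> is
    1, so there \<open>\<rho> e\<close> is just \<phi> on odd faces, and \<psi> is constant across
    adjacent exterior faces.\<close>
  define \<rho> where "\<rho> e f = \<phi> f * (if Q e then \<omega> f else 1)" for e f
  define \<psi> where "\<psi> f = (if even_face f then \<rho> f (fst f + 1, snd f) else \<phi> f)" for f
  have \<rho>_corner: "\<rho> e (odd1 v) = \<rho> e (odd2 v)" if "e = even1 v \<or> e = even2 v" for e v
    using \<phi>_gradient[of v] h_Q[OF that] \<phi>_sgn[of "odd1 v"] \<phi>_sgn[of "odd2 v"]
      sgn[of "odd1 v"] sgn[of "odd2 v"] by (auto simp: \<rho>_def split: if_splits)
  have \<rho>_around: "\<rho> (i, j) (i, j + 1) = \<psi> (i, j)" "\<rho> (i, j) (i - 1, j) = \<psi> (i, j)"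
    "\<rho> (i, j) (i, j - 1) = \<psi> (i, j)" "\<rho> (i, j) (i + 1, j) = \<psi> (i, j)" if "even (i + j)" for i j
    using that \<rho>_corner[of "(i, j)" "(i, j)"] \<rho>_corner[of "(i, j)" "(i - 1, j)"]
      \<rho>_corner[of "(i, j)" "(i - 1, j - 1)"]
    by (auto simp: \<psi>_def corner_defs even_face_def)
  have \<rho>_outside: "\<rho> e f = \<psi> f" if "f \<notin> ?D" "\<not> even_face f" for e f
    using that odd_configs_one[OF \<omega>, of f] by (auto simp: \<rho>_def \<psi>_def)
  have "{f. f \<notin> ?D \<and> \<psi> f = -1} = {}"
  proof (rule complement_connected[OF cyc])
    show "{f. f \<notin> ?D \<and> \<psi> f = -1} \<inter> ?D = {}" by blast
    \<comment> \<open>A reference face beyond the domain: its coordinates sum to 1, so it is odd,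
      and \<phi> is 1 at abscissa K.\<close>
    show "(K, 1 - K) \<notin> ?D" using K by force
    show "(K, 1 - K) \<notin> {f. f \<notin> ?D \<and> \<psi> f = -1}"
      by (simp add: \<psi>_def even_face_def \<phi>_far)
    fix i j
    show "(i, j) \<in> {f. f \<notin> ?D \<and> \<psi> f = -1} \<longleftrightarrow> (i + 1, j) \<in> {f. f \<notin> ?D \<and> \<psi> f = -1}"
      if out: "(i, j) \<notin> ?D" "(i + 1, j) \<notin> ?D"
    proof (cases "even (i + j)")
      case True
      then show ?thesis using out \<rho>_around(4)[of i j] \<rho>_outside[OF out(2), of "(i, j)"]
        by (simp add: even_face_def)
    next
      case False
      then show ?thesis using out \<rho>_around(2)[of "i + 1" j] \<rho>_outside[OF out(1), of "(i + 1, j)"]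
        by (simp add: even_face_def)
    qed
    show "(i, j) \<in> {f. f \<notin> ?D \<and> \<psi> f = -1} \<longleftrightarrow> (i, j + 1) \<in> {f. f \<notin> ?D \<and> \<psi> f = -1}"
      if out: "(i, j) \<notin> ?D" "(i, j + 1) \<notin> ?D"
    proof (cases "even (i + j)")
      case True
      then show ?thesis using out \<rho>_around(1)[of i j] \<rho>_outside[OF out(2), of "(i, j)"]
        by (simp add: even_face_def)
    next
      case False
      then show ?thesis using out \<rho>_around(3)[of i "j + 1"] \<rho>_outside[OF out(1), of "(i, j + 1)"]
        by (simp add: even_face_def)
    qed
  qed
  then have \<phi>_outside: "\<phi> f = 1" if "f \<notin> ?D" "\<not> even_face f" for f
    using that \<phi>_sgn[of f] by (auto simp: \<psi>_def)
  define \<theta> where "\<theta> f = (if even_face f then 1 else \<phi> f)" for f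
  have "\<theta> \<in> odd_configs ?D"
    using \<phi>_sgn \<phi>_outside by (auto simp: odd_configs_def \<theta>_def)
  moreover have "agree \<theta> v \<longleftrightarrow> agree \<omega> v \<or> \<not> (Q (even1 v) \<and> Q (even2 v))" for v
    using \<phi>_gradient[of v] \<phi>_sgn[of "odd1 v"] \<phi>_sgn[of "odd2 v"] sgn[of "odd1 v"] sgn[of "odd2 v"]
    by (auto simp: agree_def \<theta>_def h_def split: if_splits)
  ultimately show ?thesis by blast
qed

text \<open>The Ising partition function of the odd spins, with finite coupling on A (a disagreement
  costs x v) and infinite coupling off A.\<close>

definition odd_sum :: "vertex list \<Rightarrow> (vertex \<Rightarrow> real) \<Rightarrow> vertex set \<Rightarrow> real" where
  "odd_sum cyc x A = (\<Sum>\<omega>\<in>odd_configs (domain_faces cyc). \<Prod>v\<in>domain_vertices cyc.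
     (if agree \<omega> v then 1 else if v \<in> A then x v else 0))"

text \<open>A vertex is read as the edge joining its two even faces; these are the edges of the
  subgraph induced by S.\<close>

definition inside :: "face set \<Rightarrow> vertex set" where
  "inside S = {v. even1 v \<in> S \<and> even2 v \<in> S}"

lemma odd_sum_restrict:
  assumes "simple_cycle cyc"
  shows "odd_sum cyc x A =
    (\<Sum>\<omega> | \<omega> \<in> odd_configs (domain_faces cyc) \<and> (\<forall>v. agree \<omega> v \<or> v \<in> A).
      \<Prod>v\<in>domain_vertices cyc. if agree \<omega> v then 1 else x v)"
  unfolding odd_sum_def
proof (rule sum.mono_neutral_cong_right)
  show "finite (odd_configs (domain_faces cyc))"
    using assms by (simp add: finite_odd_configs finite_domain_faces)
  show "\<forall>\<omega>\<in>odd_configs (domain_faces cyc) -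
      {\<omega>. \<omega> \<in> odd_configs (domain_faces cyc) \<and> (\<forall>v. agree \<omega> v \<or> v \<in> A)}.
    (\<Prod>v\<in>domain_vertices cyc. if agree \<omega> v then 1 else if v \<in> A then x v else 0) = 0"
  proof
    fix \<omega> assume "\<omega> \<in> odd_configs (domain_faces cyc) -
      {\<omega>. \<omega> \<in> odd_configs (domain_faces cyc) \<and> (\<forall>v. agree \<omega> v \<or> v \<in> A)}"
    then obtain v where "\<not> agree \<omega> v" "v \<notin> A" "v \<in> domain_vertices cyc"
      using agree_outside by blast
    then show "(\<Prod>v\<in>domain_vertices cyc. if agree \<omega> v then 1 else if v \<in> A then x v else 0) = 0"
      using finite_domain_vertices[OF assms] by (intro prod_zero) auto
  qed
next
  show "(\<Prod>v\<in>domain_vertices cyc. if agree \<omega> v then 1 else if v \<in> A then x v else 0) =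
      (\<Prod>v\<in>domain_vertices cyc. if agree \<omega> v then 1 else x v)"
    if "\<omega> \<in> {\<omega>. \<omega> \<in> odd_configs (domain_faces cyc) \<and> (\<forall>v. agree \<omega> v \<or> v \<in> A)}" for \<omega>
    using that by (intro prod.cong refl) auto
qed blast

text \<open>Multiplication maps pairs of configurations, with disagreements inside S and inside its
  complement, bijectively to configurations with disagreements in the union. For two factorisations
  of one product, \<omega> * \<omega>' = \<theta> * \<theta>' can disagree neither off
  \<open>inside S\<close> nor on it, hence is 1. Conversely \<open>odd_config_restrict\<close>
  extracts the part inside S, and the quotient carries the rest. Weights multiply because the
  disagreement sets are disjoint.\<close>

lemma odd_sum_split:
  assumes cyc: "simple_cycle cyc"
  shows "odd_sum cyc x (inside S \<union> inside (- S)) = odd_sum cyc x (inside S) * odd_sum cyc x (inside (- S))"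
proof -
  let ?\<Omega> = "odd_configs (domain_faces cyc)"
  define B where "B A = {\<omega>. \<omega> \<in> ?\<Omega> \<and> (\<forall>v. agree \<omega> v \<or> v \<in> A)}" for A
  define y where "y \<omega> = (\<Prod>v\<in>domain_vertices cyc. if agree \<omega> v then 1 else x v)" for \<omega>
  have disj: "inside S \<inter> inside (- S) = {}" by (auto simp: inside_def)
  have bij: "bij_betw (\<lambda>(\<omega>, \<theta>). \<omega> * \<theta>) (B (inside S) \<times> B (inside (- S))) (B (inside S \<union> inside (- S)))"
  proof (rule bij_betw_imageI)
    show "inj_on (\<lambda>(\<omega>, \<theta>). \<omega> * \<theta>) (B (inside S) \<times> B (inside (- S)))"
    proof (rule inj_onI, clarify)
      fix \<omega> \<theta> \<omega>' \<theta>'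
      assume in_B: "\<omega> \<in> B (inside S)" "\<omega>' \<in> B (inside S)" "\<theta> \<in> B (inside (- S))" "\<theta>' \<in> B (inside (- S))"
        and eq: "\<omega> * \<theta> = \<omega>' * \<theta>'"
      then have \<Omega>: "\<omega> \<in> ?\<Omega>" "\<omega>' \<in> ?\<Omega>" "\<theta> \<in> ?\<Omega>" "\<theta>' \<in> ?\<Omega>" by (auto simp: B_def)
      have "\<omega> * \<omega>' = \<omega> * \<omega>' * (\<theta> * \<theta>)" using odd_configs_square[OF \<Omega>(3)] by simp
      also have "\<dots> = (\<omega> * \<theta>) * \<omega>' * \<theta>" by (simp only: ac_simps)
      also have "\<dots> = (\<omega>' * \<omega>') * (\<theta> * \<theta>')" unfolding eq by (simp only: ac_simps)
      finally have prod_eq: "\<omega> * \<omega>' = \<theta> * \<theta>'" using odd_configs_square[OF \<Omega>(2)] by simp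
      have "agree (\<omega> * \<omega>') v" for v
      proof (cases "v \<in> inside S")
        case True
        then have "agree \<theta> v" "agree \<theta>' v" using in_B disj by (auto simp: B_def)
        then show ?thesis using agree_mult_iff[OF \<Omega>(3,4), of v] prod_eq by simp
      next
        case False
        then have "agree \<omega> v" "agree \<omega>' v" using in_B by (auto simp: B_def)
        then show ?thesis using agree_mult_iff[OF \<Omega>(1,2), of v] by simp
      qed
      then have one: "\<omega> * \<omega>' = 1"
        using odd_config_trivial[OF finite_domain_faces[OF cyc] odd_configs_mult[OF \<Omega>(1,2)]] by blast
      have "\<omega> = \<omega> * \<omega>' * \<omega>'" using odd_configs_square[OF \<Omega>(2)] by (simp add: mult.assoc)
      then have "\<omega> = \<omega>'" using one by simp
      moreover have "\<theta> = \<theta> * \<theta>' * \<theta>'" using odd_configs_square[OF \<Omega>(4)] by (simp add: mult.assoc)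
      then have "\<theta> = \<theta>'" using one prod_eq by simp
      ultimately show "\<omega> = \<omega>' \<and> \<theta> = \<theta>'" by blast
    qed
    show "(\<lambda>(\<omega>, \<theta>). \<omega> * \<theta>) ` (B (inside S) \<times> B (inside (- S))) = B (inside S \<union> inside (- S))"
    proof (intro equalityI subsetI)
      fix \<omega> assume "\<omega> \<in> (\<lambda>(\<omega>, \<theta>). \<omega> * \<theta>) ` (B (inside S) \<times> B (inside (- S)))"
      then show "\<omega> \<in> B (inside S \<union> inside (- S))"
        by (auto simp: B_def agree_mult_iff odd_configs_mult)
    next
      fix \<omega> assume "\<omega> \<in> B (inside S \<union> inside (- S))"
      then have \<omega>: "\<omega> \<in> ?\<Omega>" "\<And>v. \<not> agree \<omega> v \<Longrightarrow> v \<in> inside S \<union> inside (- S)"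
        by (auto simp: B_def)
      then have "\<not> agree \<omega> v \<Longrightarrow> even1 v \<in> S \<longleftrightarrow> even2 v \<in> S" for v
        by (fastforce simp: inside_def)
      from odd_config_restrict[OF cyc \<omega>(1) this] obtain \<theta> where \<theta>: "\<theta> \<in> ?\<Omega>"
        "\<And>v. agree \<theta> v \<longleftrightarrow> agree \<omega> v \<or> v \<notin> inside S"
        by (auto simp: inside_def)
      have "\<theta> \<in> B (inside S)" using \<theta> by (auto simp: B_def)
      moreover have "\<omega> * \<theta> \<in> B (inside (- S))"
        using \<omega> \<theta> disj by (auto simp: B_def agree_mult_iff odd_configs_mult)
      moreover have "\<omega> = \<theta> * (\<omega> * \<theta>)"
        using odd_configs_square[OF \<theta>(1)] by (metis mult.left_commute mult_1_right)
      ultimately show "\<omega> \<in> (\<lambda>(\<omega>, \<theta>). \<omega> * \<theta>) ` (B (inside S) \<times> B (inside (- S)))"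
        by (metis (mono_tags, lifting) SigmaI case_prod_conv image_eqI)
    qed
  qed
  have "odd_sum cyc x (inside S) * odd_sum cyc x (inside (- S)) =
      (\<Sum>\<omega>\<in>B (inside S). y \<omega>) * (\<Sum>\<theta>\<in>B (inside (- S)). y \<theta>)"
    by (simp add: odd_sum_restrict[OF cyc] B_def y_def)
  also have "\<dots> = (\<Sum>(\<omega>, \<theta>)\<in>B (inside S) \<times> B (inside (- S)). y \<omega> * y \<theta>)"
    by (simp add: sum_product sum.cartesian_product)
  also have "\<dots> = (\<Sum>p\<in>B (inside S) \<times> B (inside (- S)). y (case p of (\<omega>, \<theta>) \<Rightarrow> \<omega> * \<theta>))"
  proof (rule sum.cong[OF refl], clarify)
    fix \<omega> \<theta> assume "\<omega> \<in> B (inside S)" "\<theta> \<in> B (inside (- S))"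
    then show "y \<omega> * y \<theta> = y (\<omega> * \<theta>)"
      unfolding y_def prod.distrib[symmetric] using disj
      by (intro prod.cong refl) (auto simp: B_def agree_mult_iff)
  qed
  also have "\<dots> = (\<Sum>\<omega>\<in>B (inside S \<union> inside (- S)). y \<omega>)"
    by (rule sum.reindex_bij_betw[OF bij])
  also have "\<dots> = odd_sum cyc x (inside S \<union> inside (- S))"
    by (simp add: odd_sum_restrict[OF cyc] B_def y_def)
  finally show ?thesis by simp
qed

lemma odd_sum_nonneg:
  "(\<And>v. x v \<ge> 0) \<Longrightarrow> odd_sum cyc x A \<ge> 0"
  by (auto simp: odd_sum_def intro!: sum_nonneg prod_nonneg)

lemma odd_sum_mono:
  "(\<And>v. x v \<ge> 0) \<Longrightarrow> A \<subseteq> B \<Longrightarrow> odd_sum cyc x A \<le> odd_sum cyc x B"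
  unfolding odd_sum_def by (intro sum_mono prod_mono) auto

lemma odd_sum_log_supermodular:
  assumes cyc: "simple_cycle cyc" and x: "\<And>v. 0 \<le> x v \<and> x v \<le> 1"
  shows "odd_sum cyc x A * odd_sum cyc x B \<le> odd_sum cyc x (A \<union> B) * odd_sum cyc x (A \<inter> B)"
proof -
  let ?\<Omega> = "odd_configs (domain_faces cyc)"
  interpret involutive_group ?\<Omega>
    using cyc by (intro involutive_group_odd_configs finite_domain_faces)
  define s where "s v \<omega> = real_of_int (\<omega> (odd1 v) * \<omega> (odd2 v))" for v and \<omega> :: "face \<Rightarrow> int"
  have s: "s v \<omega> = (if agree \<omega> v then 1 else -1)" if "\<omega> \<in> ?\<Omega>" for v \<omega>
    using odd_configs_sign[OF that, of "odd1 v"] odd_configs_sign[OF that, of "odd2 v"]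
    by (auto simp: s_def agree_def)
  have "character ?\<Omega> (s v)" for v
    unfolding character_def
  proof (intro conjI ballI)
    fix \<omega> \<theta> assume "\<omega> \<in> ?\<Omega>" "\<theta> \<in> ?\<Omega>"
    show "s v (\<omega> * \<theta>) = s v \<omega> * s v \<theta>" by (simp add: s_def)
    show "s v \<omega> = 1 \<or> s v \<omega> = -1" using s[OF \<open>\<omega> \<in> ?\<Omega>\<close>] by simp
  qed
  moreover have "odd_sum cyc x A =
      (\<Sum>\<omega>\<in>?\<Omega>. \<Prod>v\<in>domain_vertices cyc. if s v \<omega> = 1 then 1 else if v \<in> A then x v else 0)" for A
    unfolding odd_sum_def by (intro sum.cong prod.cong refl) (simp add: s)
  ultimately show ?thesis
    using log_supermodular_disagreement_sum[of "domain_vertices cyc" s x A B] x by simp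
qed

section \<open>The marginal on the even spins\<close>

definition even_agree :: "(face \<Rightarrow> int) \<Rightarrow> vertex \<Rightarrow> bool" where
  "even_agree \<eta> v \<longleftrightarrow> \<eta> (even1 v) = \<eta> (even2 v)"

lemma E_spin_iff:
  "\<sigma> \<in> E_spin \<longleftrightarrow> (\<forall>f. \<sigma> f = -1 \<or> \<sigma> f = 1) \<and> (\<forall>v. even_agree \<sigma> v \<or> agree \<sigma> v)"
  unfolding E_spin_def even_agree_def agree_def even1_def even2_def odd1_def odd2_def by auto

text \<open>Weights of a vertex at which only the odd, resp. only the even, diagonal pair agrees.\<close>
definition odd_weight :: "real \<Rightarrow> real \<Rightarrow> vertex \<Rightarrow> real" where
  "odd_weight a b v = (if even_face v then b else a)"
definition even_weight :: "real \<Rightarrow> real \<Rightarrow> vertex \<Rightarrow> real" where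
  "even_weight a b v = (if even_face v then a else b)"

text \<open>The value 0 where neither diagonal pair agrees encodes the constraint in
  \<open>E_spin\<close>, so that sums can run over the whole group of odd configurations.\<close>

definition vertex_weight :: "real \<Rightarrow> real \<Rightarrow> real \<Rightarrow> (face \<Rightarrow> int) \<Rightarrow> (face \<Rightarrow> int) \<Rightarrow> vertex \<Rightarrow> real" where
  "vertex_weight a b c \<eta> \<omega> v =
     (if even_agree \<eta> v then if agree \<omega> v then c else even_weight a b v
      else if agree \<omega> v then odd_weight a b v else 0)"

lemma spin_weight_eq_prod:
  assumes "simple_cycle cyc" "\<sigma> \<in> E_spin"
  shows "spin_weight a b c cyc \<sigma> = (\<Prod>v\<in>domain_vertices cyc. vertex_weight a b c \<sigma> \<sigma> v)"
proof -
  have pow: "z ^ card {v \<in> domain_vertices cyc. P v} = (\<Prod>v\<in>domain_vertices cyc. if P v then z else 1)"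
    for P and z :: real
    using finite_domain_vertices[OF assms(1)] by (simp add: prod.If_cases Int_def)
  have "(if type_a \<sigma> v then a else 1) * (if type_b \<sigma> v then b else 1) * (if type_c \<sigma> v then c else 1)
      = vertex_weight a b c \<sigma> \<sigma> v" for v
    using assms(2)
    by (auto simp: E_spin_def type_a_def type_b_def type_c_def vertex_weight_def even_agree_def
        agree_def even1_def even2_def odd1_def odd2_def odd_weight_def even_weight_def)
  then show ?thesis by (simp add: spin_weight_def pow flip: prod.distrib)
qed

definition merge :: "(face \<Rightarrow> int) \<Rightarrow> (face \<Rightarrow> int) \<Rightarrow> face \<Rightarrow> int" where
  "merge \<eta> \<omega> f = (if even_face f then \<eta> f else \<omega> f)"

lemma merge_simps [simp]:
  "even_agree (merge \<eta> \<omega>) = even_agree \<eta>" "agree (merge \<eta> \<omega>) = agree \<omega>"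
  by (auto simp: even_agree_def agree_def merge_def fun_eq_iff)

lemma vertex_weight_merge [simp]:
  "vertex_weight a b c (merge \<eta> \<omega>) (merge \<eta> \<omega>) = vertex_weight a b c \<eta> \<omega>"
  by (simp add: vertex_weight_def fun_eq_iff)

locale spin_domain =
  fixes cyc :: "vertex list" and \<tau> :: "face \<Rightarrow> int" and a b c :: real
  assumes cyc: "simple_cycle cyc" and \<tau>: "\<tau> \<in> E_spin"
    and \<tau>_odd: "\<not> even_face f \<Longrightarrow> f \<notin> domain_faces cyc \<Longrightarrow> \<tau> f = 1"
    and pos: "a > 0" "b > 0" "c > 0" and le: "a \<le> c" "b \<le> c"
begin

abbreviation "D \<equiv> domain_faces cyc"
abbreviation "V \<equiv> domain_vertices cyc"
abbreviation "\<mu> \<equiv> Spin_marginal a b c cyc \<tau>"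

definition compatible :: "(face \<Rightarrow> int) set" where
  "compatible = {\<eta> \<in> even_configs. \<forall>f. even_face f \<and> f \<notin> D \<longrightarrow> \<eta> f = \<tau> f}"

lemma spin_weight_nonneg: "spin_weight a b c cyc \<sigma> \<ge> 0"
  using pos by (simp add: spin_weight_def)

lemma Z_nonneg: "spin_Z a b c cyc \<tau> \<ge> 0"
  unfolding spin_Z_def by (intro sum_nonneg spin_weight_nonneg)

lemma Spin_prob_nonneg: "Spin_prob a b c cyc \<tau> \<sigma> \<ge> 0"
  using spin_weight_nonneg Z_nonneg by (simp add: Spin_prob_def)

lemma marginal_nonneg: "\<mu> \<eta> \<ge> 0"
  unfolding Spin_marginal_def by (intro sum_nonneg Spin_prob_nonneg)

lemma spin_configs_sign: "\<sigma> \<in> spin_configs cyc \<tau> \<Longrightarrow> \<sigma> f = -1 \<or> \<sigma> f = 1"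
  by (auto simp: spin_configs_def E_spin_def)

lemma bullet_compatible: "\<sigma> \<in> spin_configs cyc \<tau> \<Longrightarrow> bullet \<sigma> \<in> compatible"
  by (auto simp: compatible_def even_configs_def bullet_def spin_configs_sign)
    (auto simp: spin_configs_def)

lemma merge_in_spin_configs_iff:
  assumes \<eta>: "\<eta> \<in> compatible" and \<omega>: "\<omega> \<in> odd_configs D"
  shows "merge \<eta> \<omega> \<in> spin_configs cyc \<tau> \<longleftrightarrow> (\<forall>v\<in>V. even_agree \<eta> v \<or> agree \<omega> v)"
proof -
  have "merge \<eta> \<omega> f = -1 \<or> merge \<eta> \<omega> f = 1" for f
    using \<eta> odd_configs_sign[OF \<omega>, of f] by (auto simp: merge_def compatible_def even_configs_def)
  moreover have "merge \<eta> \<omega> f = \<tau> f" if "f \<notin> D" for f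
    using \<eta> that odd_configs_one[OF \<omega>, of f] \<tau>_odd[of f] by (auto simp: merge_def compatible_def)
  moreover have "agree \<omega> v" if "v \<notin> V" for v using agree_outside[OF \<omega> that] .
  ultimately show ?thesis by (simp add: spin_configs_def E_spin_iff) blast
qed

lemma marginal_eq:
  assumes \<eta>: "\<eta> \<in> compatible"
  shows "\<mu> \<eta> = (\<Sum>\<omega>\<in>odd_configs D. \<Prod>v\<in>V. vertex_weight a b c \<eta> \<omega> v) / spin_Z a b c cyc \<tau>"
proof -
  let ?S = "{\<sigma> \<in> spin_configs cyc \<tau>. bullet \<sigma> = \<eta>}"
  let ?O = "{\<omega> \<in> odd_configs D. merge \<eta> \<omega> \<in> spin_configs cyc \<tau>}"
  have \<eta>_odd: "\<not> even_face f \<Longrightarrow> \<eta> f = 0" for f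
    using \<eta> by (auto simp: compatible_def even_configs_def)
  have "(\<Sum>\<sigma>\<in>?S. spin_weight a b c cyc \<sigma>) = (\<Sum>\<omega>\<in>?O. \<Prod>v\<in>V. vertex_weight a b c \<eta> \<omega> v)"
  \<comment> \<open>\<open>merge 1\<close> freezes the even spins at 1 and so extracts the odd part;
    \<open>merge \<eta>\<close> puts the even spins back.\<close>
  proof (rule sum.reindex_bij_witness[where i = "merge \<eta>" and j = "merge 1"])
    fix \<sigma> assume \<sigma>: "\<sigma> \<in> ?S"
    then have "bullet \<sigma> = \<eta>" by simp
    then show eq: "merge \<eta> (merge 1 \<sigma>) = \<sigma>"
      by (intro ext) (auto simp: merge_def bullet_def)
    have "merge 1 \<sigma> \<in> odd_configs D"
      using \<sigma> \<tau>_odd spin_configs_sign[of \<sigma>]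
      by (auto simp: odd_configs_def merge_def spin_configs_def)
    then show "merge 1 \<sigma> \<in> ?O" using \<sigma> eq by simp
    have "vertex_weight a b c \<eta> (merge 1 \<sigma>) = vertex_weight a b c \<sigma> \<sigma>"
      by (metis eq vertex_weight_merge)
    then show "(\<Prod>v\<in>V. vertex_weight a b c \<eta> (merge 1 \<sigma>) v) = spin_weight a b c cyc \<sigma>"
      using \<sigma> by (simp add: spin_weight_eq_prod[OF cyc] spin_configs_def)
  next
    fix \<omega> assume \<omega>: "\<omega> \<in> ?O"
    then show "merge 1 (merge \<eta> \<omega>) = \<omega>"
      by (auto simp: merge_def fun_eq_iff odd_configs_one)
    show "merge \<eta> \<omega> \<in> ?S"
      using \<omega> \<eta>_odd by (auto simp: bullet_def merge_def fun_eq_iff)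
  qed
  also have "\<dots> = (\<Sum>\<omega>\<in>odd_configs D. \<Prod>v\<in>V. vertex_weight a b c \<eta> \<omega> v)"
  proof (rule sum.mono_neutral_left)
    show "finite (odd_configs D)" using cyc by (simp add: finite_odd_configs finite_domain_faces)
    show "\<forall>\<omega>\<in>odd_configs D - ?O. (\<Prod>v\<in>V. vertex_weight a b c \<eta> \<omega> v) = 0"
    proof
      fix \<omega> assume "\<omega> \<in> odd_configs D - ?O"
      then obtain v where "v \<in> V" "\<not> even_agree \<eta> v" "\<not> agree \<omega> v"
        using merge_in_spin_configs_iff[OF \<eta>] by blast
      then show "(\<Prod>v\<in>V. vertex_weight a b c \<eta> \<omega> v) = 0"
        using finite_domain_vertices[OF cyc] by (intro prod_zero) (auto simp: vertex_weight_def)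
    qed
  qed blast
  finally show ?thesis
    by (simp add: Spin_marginal_def Spin_prob_def flip: sum_divide_distrib)
qed

section \<open>Factorisation of the marginal and the lattice condition\<close>

definition even_prod :: "(face \<Rightarrow> int) \<Rightarrow> real" where
  "even_prod \<eta> = (\<Prod>v\<in>V. if even_agree \<eta> v then c else odd_weight a b v)"

abbreviation "x \<equiv> \<lambda>v. even_weight a b v / c"
abbreviation "P \<equiv> \<lambda>S. odd_sum cyc x (inside S)"

lemma x_bounds: "0 \<le> x v \<and> x v \<le> 1"
  using pos le by (simp add: even_weight_def)

text \<open>Pulling out of each vertex its weight for an agreeing odd pair leaves 1 at an agreement
  and x v or 0 at a disagreement. The 0 occurs exactly where the even pair joins a plus face to a
  minus face, so \<open>odd_sum_split\<close> applies.\<close>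

lemma marginal_factor:
  assumes \<eta>: "\<eta> \<in> compatible"
  shows "\<mu> \<eta> = even_prod \<eta> * P {f. \<eta> f = 1} * P (- {f. \<eta> f = 1}) / spin_Z a b c cyc \<tau>"
proof -
  have sgn: "\<eta> f = -1 \<or> \<eta> f = 1" if "even_face f" for f
    using \<eta> that by (auto simp: compatible_def even_configs_def)
  have ins: "v \<in> inside {f. \<eta> f = 1} \<union> inside (- {f. \<eta> f = 1}) \<longleftrightarrow> even_agree \<eta> v" for v
    using sgn[of "even1 v"] sgn[of "even2 v"] by (auto simp: inside_def even_agree_def)
  have "vertex_weight a b c \<eta> \<omega> v = (if even_agree \<eta> v then c else odd_weight a b v) *
      (if agree \<omega> v then 1 else if even_agree \<eta> v then x v else 0)" for \<omega> v
    using pos by (simp add: vertex_weight_def)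
  then have "(\<Sum>\<omega>\<in>odd_configs D. \<Prod>v\<in>V. vertex_weight a b c \<eta> \<omega> v) =
      even_prod \<eta> * odd_sum cyc x (inside {f. \<eta> f = 1} \<union> inside (- {f. \<eta> f = 1}))"
    by (simp only: odd_sum_def ins even_prod_def prod.distrib sum_distrib_left)
  then show ?thesis
    unfolding marginal_eq[OF \<eta>] odd_sum_split[OF cyc] by (simp add: mult.assoc)
qed

text \<open>Edges between S and T may lie inside S \<union> T without lying inside either set;
  monotonicity in the edge set absorbs them.\<close>

lemma P_log_supermodular: "P S * P T \<le> P (S \<union> T) * P (S \<inter> T)"
proof -
  have x: "\<And>v. x v \<ge> 0" using x_bounds by blast
  have "P S * P T \<le> odd_sum cyc x (inside S \<union> inside T) * odd_sum cyc x (inside S \<inter> inside T)"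
    by (rule odd_sum_log_supermodular[OF cyc x_bounds])
  also have "inside S \<inter> inside T = inside (S \<inter> T)" by (auto simp: inside_def)
  also have "odd_sum cyc x (inside S \<union> inside T) * P (S \<inter> T) \<le> P (S \<union> T) * P (S \<inter> T)"
    by (intro mult_right_mono odd_sum_mono odd_sum_nonneg x) (auto simp: inside_def)
  finally show ?thesis .
qed

lemma even_prod_nonneg: "even_prod \<eta> \<ge> 0"
  using pos by (auto simp: even_prod_def odd_weight_def intro!: prod_nonneg)

text \<open>At a single vertex the two sides differ only if \<eta> and \<zeta> disagree across the
  even pair in opposite senses; then the square of the odd weight is replaced by the square of
  c.\<close>

lemma even_prod_log_supermodular:
  assumes "\<eta> \<in> even_configs" "\<zeta> \<in> even_configs"
  shows "even_prod \<eta> * even_prod \<zeta> \<le> even_prod (sup \<eta> \<zeta>) * even_prod (inf \<eta> \<zeta>)"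
proof -
  let ?k = "\<lambda>\<eta> v. if even_agree \<eta> v then c else odd_weight a b v"
  have w: "0 < odd_weight a b v" "odd_weight a b v \<le> c" for v
    using pos le by (auto simp: odd_weight_def)
  have "?k \<eta> v * ?k \<zeta> v \<le> ?k (sup \<eta> \<zeta>) v * ?k (inf \<eta> \<zeta>) v" for v
  proof -
    have "\<eta> f = -1 \<or> \<eta> f = 1" "\<zeta> f = -1 \<or> \<zeta> f = 1" if "even_face f" for f
      using assms that by (auto simp: even_configs_def)
    note this[OF parity_corners(1)[of v]] this[OF parity_corners(2)[of v]]
    moreover have "odd_weight a b v * odd_weight a b v \<le> c * c"
      "odd_weight a b v * c \<le> c * c" using w[of v] pos by (auto intro: mult_mono)
    ultimately show ?thesis
      by (elim disjE) (simp_all add: even_agree_def sup_int_def inf_int_def mult.commute)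
  qed
  then show ?thesis
    unfolding even_prod_def prod.distrib[symmetric]
    using w pos by (intro prod_mono) (auto intro!: mult_nonneg_nonneg simp: less_imp_le)
qed

lemma compatible_sup_inf:
  assumes "\<eta> \<in> compatible" "\<zeta> \<in> compatible"
  shows "sup \<eta> \<zeta> \<in> compatible" "inf \<eta> \<zeta> \<in> compatible"
  using assms by (auto simp: compatible_def even_configs_def sup_int_def inf_int_def max_def min_def)

lemma marginal_log_supermodular:
  assumes \<eta>: "\<eta> \<in> compatible" and \<zeta>: "\<zeta> \<in> compatible"
  shows "\<mu> \<eta> * \<mu> \<zeta> \<le> \<mu> (sup \<eta> \<zeta>) * \<mu> (inf \<eta> \<zeta>)"
proof -
  \<comment> \<open>Odd faces have value 0 and fall into the complements, which does no harm because
    \<open>inside\<close> looks at even faces only.\<close>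
  let ?S = "{f. \<eta> f = 1}" and ?T = "{f. \<zeta> f = 1}" and ?Z = "spin_Z a b c cyc \<tau>"
  have le1: "\<eta> f \<le> 1" "\<zeta> f \<le> 1" for f
    using \<eta> \<zeta> by (cases "even_face f"; force simp: compatible_def even_configs_def)+
  have sets: "{f. sup \<eta> \<zeta> f = 1} = ?S \<union> ?T" "{f. inf \<eta> \<zeta> f = 1} = ?S \<inter> ?T"
    using le1 by (auto simp: sup_int_def inf_int_def max_def min_def antisym split: if_splits)
  have P0: "P S \<ge> 0" for S using x_bounds by (intro odd_sum_nonneg) blast
  have "(even_prod \<eta> * even_prod \<zeta>) * ((P ?S * P ?T) * (P (- ?S) * P (- ?T))) \<le>
      (even_prod (sup \<eta> \<zeta>) * even_prod (inf \<eta> \<zeta>)) *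
      ((P (?S \<union> ?T) * P (?S \<inter> ?T)) * (P (- ?S \<union> - ?T) * P (- ?S \<inter> - ?T)))"
    using \<eta> \<zeta> by (intro mult_mono even_prod_log_supermodular P_log_supermodular
      mult_nonneg_nonneg even_prod_nonneg P0) (auto simp: compatible_def)
  from divide_right_mono[OF this, of "?Z * ?Z"]
  show ?thesis
    unfolding marginal_factor[OF \<eta>] marginal_factor[OF \<zeta>]
      marginal_factor[OF compatible_sup_inf(1)[OF \<eta> \<zeta>]]
      marginal_factor[OF compatible_sup_inf(2)[OF \<eta> \<zeta>]] sets
    by (simp add: ac_simps Compl_Un Compl_Int)
qed

lemma marginal_eq_0: "\<eta> \<notin> compatible \<Longrightarrow> \<mu> \<eta> = 0"
  using bullet_compatible by (auto simp: Spin_marginal_def intro!: sum.neutral)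

lemma FKG_lattice_marginal: "FKG_lattice \<mu>"
  unfolding FKG_lattice_def
proof (intro ballI)
  fix \<eta> \<zeta>
  show "\<mu> \<eta> * \<mu> \<zeta> \<le> \<mu> (sup \<eta> \<zeta>) * \<mu> (inf \<eta> \<zeta>)"
    using marginal_log_supermodular[of \<eta> \<zeta>] marginal_eq_0 marginal_nonneg
    by (cases "\<eta> \<in> compatible \<and> \<zeta> \<in> compatible") auto
qed

section \<open>From the lattice condition to the correlation inequality\<close>

lemma finite_spin_configs: "finite (spin_configs cyc \<tau>)"
proof (rule inj_on_finite[where B = "Pow D"])
  show "inj_on (\<lambda>\<sigma>. {f \<in> D. \<sigma> f = 1}) (spin_configs cyc \<tau>)"
  proof (rule inj_onI, rule ext)
    fix \<sigma> \<sigma>' f assume *: "\<sigma> \<in> spin_configs cyc \<tau>" "\<sigma>' \<in> spin_configs cyc \<tau>"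
      "{f \<in> D. \<sigma> f = 1} = {f \<in> D. \<sigma>' f = 1}"
    then have "f \<in> D \<Longrightarrow> \<sigma> f = 1 \<longleftrightarrow> \<sigma>' f = 1" by blast
    then show "\<sigma> f = \<sigma>' f"
      using spin_configs_sign[OF *(1), of f] spin_configs_sign[OF *(2), of f] *(1,2)
      by (cases "f \<in> D") (auto simp: spin_configs_def)
  qed
qed (use finite_domain_faces[OF cyc] in auto)

text \<open>Parametrises \<open>compatible\<close> by the set of plus faces in the domain, turning
  union and intersection into \<open>sup\<close> and \<open>inf\<close>; the set form of the FKG
  inequality then applies.\<close>

definition even_of :: "face set \<Rightarrow> face \<Rightarrow> int" where
  "even_of X f = (if even_face f then if f \<in> D then if f \<in> X then 1 else -1 else \<tau> f else 0)"

lemma even_of_compatible: "even_of X \<in> compatible"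
  using \<tau> by (auto simp: compatible_def even_configs_def even_of_def E_spin_def)

lemma even_of_sup_inf: "even_of (X \<union> Y) = sup (even_of X) (even_of Y)"
  "even_of (X \<inter> Y) = inf (even_of X) (even_of Y)"
  by (auto simp: even_of_def fun_eq_iff sup_int_def inf_int_def)

lemma even_of_mono: "X \<subseteq> Y \<Longrightarrow> even_of X \<le> even_of Y"
  by (auto simp: even_of_def le_fun_def)

abbreviation "A \<equiv> {f \<in> D. even_face f}"

lemma bullet_eq_even_of_iff:
  assumes "\<sigma> \<in> spin_configs cyc \<tau>" "X \<subseteq> A"
  shows "bullet \<sigma> = even_of X \<longleftrightarrow> {f \<in> A. \<sigma> f = 1} = X"
proof
  assume eq: "bullet \<sigma> = even_of X"
  have "f \<in> A \<Longrightarrow> \<sigma> f = 1 \<longleftrightarrow> f \<in> X" for f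
    using fun_cong[OF eq, of f] by (auto simp: bullet_def even_of_def split: if_splits)
  then show "{f \<in> A. \<sigma> f = 1} = X" using assms(2) by blast
next
  assume eq: "{f \<in> A. \<sigma> f = 1} = X"
  have out: "f \<notin> D \<Longrightarrow> \<sigma> f = \<tau> f" for f using assms(1) by (auto simp: spin_configs_def)
  have "f \<in> X \<longleftrightarrow> f \<in> A \<and> \<sigma> f = 1" for f using eq by blast
  then show "bullet \<sigma> = even_of X"
    using spin_configs_sign[OF assms(1)] out by (auto simp: bullet_def even_of_def fun_eq_iff)
qed

lemma Spin_expect_bullet:
  "Spin_expect a b c cyc \<tau> (\<lambda>\<sigma>. F (bullet \<sigma>)) = (\<Sum>X\<in>Pow A. F (even_of X) * \<mu> (even_of X))"
proof -
  have "Spin_expect a b c cyc \<tau> (\<lambda>\<sigma>. F (bullet \<sigma>)) =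
      (\<Sum>X\<in>Pow A. \<Sum>\<sigma> | \<sigma> \<in> spin_configs cyc \<tau> \<and> {f \<in> A. \<sigma> f = 1} = X.
        F (bullet \<sigma>) * Spin_prob a b c cyc \<tau> \<sigma>)"
    unfolding Spin_expect_def
    by (rule sum.group[symmetric]) (use finite_spin_configs finite_domain_faces[OF cyc] in auto)
  also have "\<dots> = (\<Sum>X\<in>Pow A. F (even_of X) * \<mu> (even_of X))"
  proof (rule sum.cong[OF refl])
    fix X assume "X \<in> Pow A"
    then have eq: "{\<sigma> \<in> spin_configs cyc \<tau>. {f \<in> A. \<sigma> f = 1} = X} =
        {\<sigma> \<in> spin_configs cyc \<tau>. bullet \<sigma> = even_of X}"
      using bullet_eq_even_of_iff by blast
    show "(\<Sum>\<sigma> | \<sigma> \<in> spin_configs cyc \<tau> \<and> {f \<in> A. \<sigma> f = 1} = X.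
        F (bullet \<sigma>) * Spin_prob a b c cyc \<tau> \<sigma>) = F (even_of X) * \<mu> (even_of X)"
      unfolding eq Spin_marginal_def sum_distrib_left by (rule sum.cong) auto
  qed
  finally show ?thesis .
qed

lemma FKG_bullet:
  assumes f: "increasing_even f" and g: "increasing_even g"
  shows "Spin_expect a b c cyc \<tau> (\<lambda>\<sigma>. f (bullet \<sigma>)) * Spin_expect a b c cyc \<tau> (\<lambda>\<sigma>. g (bullet \<sigma>))
    \<le> Spin_expect a b c cyc \<tau> (\<lambda>\<sigma>. f (bullet \<sigma>) * g (bullet \<sigma>))"
\<comment> \<open>Division by zero gives 0, so in the first case all expectations vanish.\<close>
proof (cases "spin_Z a b c cyc \<tau> = 0")
  case True
  then show ?thesis by (simp add: Spin_expect_def Spin_prob_def)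
next
  case False
  have incr: "F (even_of X) \<le> F (even_of Y)" if "increasing_even F" "X \<subseteq> Y" for F X Y
    using that even_of_mono even_of_compatible by (auto simp: increasing_even_def compatible_def)
  have "(\<Sum>X\<in>Pow A. \<mu> (even_of X)) = (\<Sum>\<sigma>\<in>spin_configs cyc \<tau>. Spin_prob a b c cyc \<tau> \<sigma>)"
    using Spin_expect_bullet[of "\<lambda>_. 1"] by (simp add: Spin_expect_def)
  also have "\<dots> = 1"
    using False by (simp add: Spin_prob_def spin_Z_def flip: sum_divide_distrib)
  finally have total: "(\<Sum>X\<in>Pow A. \<mu> (even_of X)) = 1" .
  have "(\<Sum>X\<in>Pow A. f (even_of X) * \<mu> (even_of X)) * (\<Sum>X\<in>Pow A. g (even_of X) * \<mu> (even_of X)) \<le>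
    (\<Sum>X\<in>Pow A. f (even_of X) * g (even_of X) * \<mu> (even_of X)) * (\<Sum>X\<in>Pow A. \<mu> (even_of X))"
    using finite_domain_faces[OF cyc] incr[OF f] incr[OF g]
    by (intro FKG_inequality)
      (auto simp: marginal_nonneg even_of_sup_inf intro: marginal_log_supermodular even_of_compatible)
  then show ?thesis
    using Spin_expect_bullet[of f] Spin_expect_bullet[of g] Spin_expect_bullet[of "\<lambda>\<eta>. f \<eta> * g \<eta>"] total
    by simp
qed

end

theorem theorem2p5:
  fixes cyc :: "vertex list" and \<tau> :: "face \<Rightarrow> int" and a b c :: real
  assumes "simple_cycle cyc"
    and "\<tau> \<in> E_spin"
    and "\<forall>f. \<not> even_face f \<and> f \<notin> domain_faces cyc \<longrightarrow> \<tau> f = 1"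
    and "a > 0" and "b > 0" and "c > 0" and "a \<le> c" and "b \<le> c"
  shows "FKG_lattice (Spin_marginal a b c cyc \<tau>) \<and>
    (\<forall>f g. increasing_even f \<and> increasing_even g \<longrightarrow>
       Spin_expect a b c cyc \<tau> (\<lambda>\<sigma>. f (bullet \<sigma>) * g (bullet \<sigma>))
         \<ge> Spin_expect a b c cyc \<tau> (\<lambda>\<sigma>. f (bullet \<sigma>)) * Spin_expect a b c cyc \<tau> (\<lambda>\<sigma>. g (bullet \<sigma>)))"
proof -
  interpret spin_domain cyc \<tau> a b c
    using assms by unfold_locales auto
  show ?thesis using FKG_lattice_marginal FKG_bullet by blast
qed

end
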